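(* Let $\ell\ge3$ and $0\le t\le\ell$ be integers, and let $C$ be an oriented cycle obtained by reversing the orientation of $t$ edges of the directed cycle $C_\ell$, such that $\mathcal{C}(P_3,C)=0$ and $\mathcal{C}(P_5,C)\notin\{0,-\mathcal{C}(2P_3,C)\}$. (i) If $\mathcal{C}(P_5,C)>0$ and $\mathcal{C}(P_5,C)>-\mathcal{C}(2P_3,C)$, and one of the following holds: $\ell$ is odd; or $\ell\equiv0\pmod4$ and $t$ is even; or $\ell\equiv2\pmod4$ and $t$ is odd; then $C$ is locally tournament Sidorenko (LTS). (ii) If $\mathcal{C}(P_5,C)<0$ and $\mathcal{C}(P_5,C)<-\mathcal{C}(2P_3,C)$, and one of the following holds: $\ell$ is odd; or $\ell\equiv0\pmod4$ and $t$ is odd; or $\ell\equiv2\pmod4$ and $t$ is even; then $C$ is locally tournament anti-Sidorenko (LTAS). (iii) Otherwise, $C$ is neither LTS nor LTAS.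
   Context: $C_\ell$ is the cycle of length $\ell$ with all edges oriented clockwise. $P_m$ is the directed path on $m$ vertices with all edges oriented left to right; $2P_3$ is the vertex-disjoint union of two copies of $P_3$. For $G=P_{2k+1}$ ($k\ge1$) or $G=2P_3$ and a digraph $D$, the signed count $\mathcal{C}(G,D)$ is the sum of $(-1)^{r(D')}$ over all (not necessarily induced) subgraphs $D'$ of $D$ without isolated vertices whose underlying undirected graph is isomorphic to that of $G$, where $r(D')$ is the number of edges of $G$ whose direction is reversed under an isomorphism from the underlying graph of $G$ to that of $D'$ (its parity is independent of the isomorphism because each component has an even number of edges). A weighted tournament on $n$ vertices is a function $A:[n]^2\to[0,1]$ with $A(x,y)+A(y,x)=1$ for all $x,y$ (so $A(x,x)=1/2$). For a digraph $D$, $t_D(A)=n^{-v(D)}\sum_{\phi:V(D)\to[n]}\prod_{(x,y)\in E(D)}A(\phi(x),\phi(y))$. Write $A=\frac12J+B$ with $J$ the all-ones matrix and $B$ skew-symmetric, and let $\lambda_{\max}(B)$ be the largest modulus of an eigenvalue of $B$. $D$ is LTS if there is $\varepsilon=\varepsilon(D)>0$ such that for every $n$ and every weighted tournament $A=\frac12J+B$ on $n$ vertices with $\lambda_{\max}(B)\le\varepsilon n$ one has $t_D(A)\ge2^{-e(D)}$; it is LTAS if there is such an $\varepsilon$ with $t_D(A)\le2^{-e(D)}$ for all such $A$. *)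

theory Defs
  imports
    "HOL-Library.FuncSet"
    "Graph_Theory.Digraph_Component"
    "Jordan_Normal_Form.Spectral_Radius"
begin

section \<open>Oriented paths and cycles\<close>

definition directed_path :: "nat \<Rightarrow> nat pair_pre_digraph" where
  "directed_path m = \<lparr> pverts = {..<m}, parcs = {(i, Suc i) | i. Suc i < m} \<rparr>"

definition two_directed_P3 :: "nat pair_pre_digraph" where
  "two_directed_P3 = \<lparr> pverts = {..<6}, parcs = {(0, 1), (1, 2), (3, 4), (4, 5)} \<rparr>"

definition directed_cycle :: "nat \<Rightarrow> nat pair_pre_digraph" where
  "directed_cycle l = \<lparr> pverts = {..<l}, parcs = {(i, Suc i mod l) | i. i < l} \<rparr>"

definition reverse_arcs :: "'a rel \<Rightarrow> 'a pair_pre_digraph \<Rightarrow> 'a pair_pre_digraph" where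
  "reverse_arcs R D = D \<lparr> parcs := (parcs D - R) \<union> R\<inverse> \<rparr>"


section \<open>Signed subgraph counts\<close>

definition no_isolated_verts :: "'a pair_pre_digraph \<Rightarrow> bool" where
  "no_isolated_verts H \<longleftrightarrow> (\<forall>v \<in> pverts H. \<exists>e \<in> parcs H. v = fst e \<or> v = snd e)"

text \<open>Isomorphisms of the underlying undirected graphs, which are represented, as in the
  library, by their symmetric closures.\<close>

definition underlying_iso ::
    "('a \<Rightarrow> 'b) \<Rightarrow> 'a pair_pre_digraph \<Rightarrow> 'b pair_pre_digraph \<Rightarrow> bool" where
  "underlying_iso f G H \<longleftrightarrow>
     bij_betw f (pverts G) (pverts H) \<and>
     (\<forall>u \<in> pverts G. \<forall>v \<in> pverts G.
        (u, v) \<in> parcs (mk_symmetric (with_proj G)) \<longleftrightarrow>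
        (f u, f v) \<in> parcs (mk_symmetric (with_proj H)))"

definition reversed_count ::
    "('a \<Rightarrow> 'b) \<Rightarrow> 'a pair_pre_digraph \<Rightarrow> 'b pair_pre_digraph \<Rightarrow> nat" where
  "reversed_count f G H = card {(u, v) \<in> parcs G. (f v, f u) \<in> parcs H}"

text \<open>The host \<open>D\<close> is meant to be finite and to have no two antiparallel arcs. The isomorphism
  is picked by \<open>SOME\<close>; when every component of \<open>G\<close> is a path with an even number of edges, the
  parity of the number of reversed edges does not depend on the choice.\<close>

definition signed_count :: "'a pair_pre_digraph \<Rightarrow> 'b pair_pre_digraph \<Rightarrow> int" where
  "signed_count G D =
     (\<Sum>H \<in> {H. subgraph (with_proj H) (with_proj D) \<and> no_isolated_verts H \<and>
                (\<exists>f. underlying_iso f G H)}.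
        (- 1) ^ reversed_count (SOME f. underlying_iso f G H) G H)"


section \<open>Weighted tournaments and the local Sidorenko properties\<close>

definition weighted_tournament :: "nat \<Rightarrow> real mat \<Rightarrow> bool" where
  "weighted_tournament n A \<longleftrightarrow>
     0 < n \<and> A \<in> carrier_mat n n \<and>
     (\<forall>x < n. \<forall>y < n. 0 \<le> A $$ (x, y) \<and> A $$ (x, y) \<le> 1 \<and> A $$ (x, y) + A $$ (y, x) = 1)"

definition hom_density :: "'a pair_pre_digraph \<Rightarrow> nat \<Rightarrow> real mat \<Rightarrow> real" where
  "hom_density D n A =
     (\<Sum>\<phi> \<in> pverts D \<rightarrow>\<^sub>E {..<n}. \<Prod>(x, y) \<in> parcs D. A $$ (\<phi> x, \<phi> y)) / real n ^ card (pverts D)"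

definition skew_part :: "nat \<Rightarrow> real mat \<Rightarrow> real mat" where
  "skew_part n A = A - (1 / 2) \<cdot>\<^sub>m mat n n (\<lambda>_. 1)"

text \<open>The eigenvalues of a real skew-symmetric matrix are purely imaginary, so they are taken
  over the complex numbers.\<close>

definition lambda_max :: "real mat \<Rightarrow> real" where
  "lambda_max B = spectral_radius (map_mat complex_of_real B)"

definition LTS :: "'a pair_pre_digraph \<Rightarrow> bool" where
  "LTS D \<longleftrightarrow>
     (\<exists>\<epsilon> > 0. \<forall>n A. weighted_tournament n A \<and> lambda_max (skew_part n A) \<le> \<epsilon> * real n \<longrightarrow>
        hom_density D n A \<ge> (1 / 2) ^ card (parcs D))"

definition LTAS :: "'a pair_pre_digraph \<Rightarrow> bool" where
  "LTAS D \<longleftrightarrow>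
     (\<exists>\<epsilon> > 0. \<forall>n A. weighted_tournament n A \<and> lambda_max (skew_part n A) \<le> \<epsilon> * real n \<longrightarrow>
        hom_density D n A \<le> (1 / 2) ^ card (parcs D))"

end

theory Submission
  imports Defs "HOL-Analysis.Convex"
begin

text \<open>Write \<open>A = J/2 + B\<close> and expand \<open>t_C(A)\<close> over the subsets \<open>S\<close> of the edges of the cycle that
  take the factor \<open>\<plusminus>B\<close>. A proper subset splits into directed paths (runs), and a path with \<open>k\<close> edges
  contributes \<open>1\<^sup>T B\<^sup>k 1 / n\<^sup>k\<^sup>+\<^sup>1\<close>, which is \<open>0\<close> for odd \<open>k\<close> and \<open>(-1)\<^sup>m a\<^sub>m\<close> with
  \<open>a\<^sub>m = |B\<^sup>m 1|\<^sup>2 / n\<^sup>2\<^sup>m\<^sup>+\<^sup>1\<close> for \<open>k = 2m\<close>. Writing \<open>p\<close>, \<open>q\<close> for the signed counts of \<open>P_5\<close>, \<open>2P_3\<close>,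
  and since that of \<open>P_3\<close> vanishes, the leading term is a positive multiple of \<open>p a\<^sub>2 + q a\<^sub>1\<^sup>2\<close>, where
  \<open>a\<^sub>1\<^sup>2 \<le> a\<^sub>2\<close> by the Cauchy-Schwarz inequality. All other proper subsets
  contribute \<open>O(\<epsilon> a\<^sub>2)\<close> when the spectral radius of \<open>B\<close> is at most \<open>\<epsilon> n\<close>, and the full edge set contributes
  a multiple of \<open>tr B\<^sup>l\<close>, whose sign depends only on \<open>l\<close> and \<open>t\<close>.

  In the remaining cases both signs of \<open>t_C(A) - 2\<^sup>-\<^sup>l\<close> occur for small multiples of suitable kernels: a single
  weighted edge on \<open>n\<close> vertices has \<open>a\<^sub>1\<^sup>2 = (2/n) a\<^sub>2\<close>, so it realises the sign of \<open>p + q\<close> for \<open>n = 2\<close>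
  and the sign of \<open>p\<close> for large \<open>n\<close>, while the cyclic triangle has \<open>B1 = 0\<close>, so that only \<open>tr B\<^sup>l\<close>
  survives.\<close>

section \<open>Homomorphism sums of weighted kernels\<close>

lemma sum_PiE_insert:
  assumes "a \<notin> S"
  shows "(\<Sum>\<phi> \<in> PiE (insert a S) T. g \<phi>) = (\<Sum>y \<in> T a. \<Sum>\<psi> \<in> PiE S T. g (\<psi>(a := y)))"
  unfolding PiE_insert_eq
  by (subst sum.reindex[OF inj_combinator[OF assms]]) (simp add: sum.cartesian_product case_prod_beta)

text \<open>The vertex set is an argument of its own: a vertex met by no arc contributes a factor
  \<open>n\<close>, so a cycle can be cut into vertex-disjoint pieces.\<close>

definition hom_sum :: "nat \<Rightarrow> (nat \<Rightarrow> nat \<Rightarrow> real) \<Rightarrow> 'a set \<Rightarrow> 'a rel \<Rightarrow> real" where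
  "hom_sum n b V E = (\<Sum>\<phi> \<in> V \<rightarrow>\<^sub>E {..<n}. \<Prod>(u, v) \<in> E. b (\<phi> u) (\<phi> v))"

lemma hom_sum_no_arcs: "finite V \<Longrightarrow> hom_sum n b V {} = real n ^ card V"
  by (simp add: hom_sum_def card_PiE)

text \<open>A map on a disjoint union is a pair of maps, and each arc sees only one of the
  two.\<close>

lemma hom_sum_Un:
  assumes "V \<inter> V' = {}" "E \<subseteq> V \<times> V" "E' \<subseteq> V' \<times> V'" "finite V" "finite V'"
  shows "hom_sum n b (V \<union> V') (E \<union> E') = hom_sum n b V E * hom_sum n b V' E'"
proof -
  have fin: "finite E" "finite E'"
    using assms(4,5) finite_subset[OF assms(2)] finite_subset[OF assms(3)] by auto
  have disj: "E \<inter> E' = {}" using assms by auto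
  have "hom_sum n b V E * hom_sum n b V' E' =
    (\<Sum>(\<phi>, \<psi>) \<in> (V \<rightarrow>\<^sub>E {..<n}) \<times> (V' \<rightarrow>\<^sub>E {..<n}).
       (\<Prod>(u, v) \<in> E. b (\<phi> u) (\<phi> v)) * (\<Prod>(u, v) \<in> E'. b (\<psi> u) (\<psi> v)))"
    by (simp add: hom_sum_def sum_product sum.cartesian_product)
  also have "\<dots> = (\<Sum>\<phi> \<in> V \<union> V' \<rightarrow>\<^sub>E {..<n}. \<Prod>(u, v) \<in> E \<union> E'. b (\<phi> u) (\<phi> v))"
  proof (rule sum.reindex_bij_witness[where
        j = "\<lambda>(\<phi>, \<psi>) x. if x \<in> V then \<phi> x else \<psi> x" and
        i = "\<lambda>\<phi>. (restrict \<phi> V, restrict \<phi> V')"], goal_cases)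
    case (1 a)
    then show ?case using assms(1)
      by (auto simp: PiE_def extensional_def restrict_def fun_eq_iff Pi_def disjoint_iff)
  next
    case (2 a)
    then show ?case by (auto simp: PiE_def Pi_def extensional_def)
  next
    case (3 b)
    then show ?case by (auto simp: PiE_def extensional_def restrict_def fun_eq_iff)
  next
    case (4 b)
    then show ?case by (auto simp: PiE_def Pi_def)
  next
    case (5 a)
    obtain \<phi> \<psi> where a: "a = (\<phi>, \<psi>)" by fastforce
    have "(\<Prod>(u, v) \<in> E. b (if u \<in> V then \<phi> u else \<psi> u) (if v \<in> V then \<phi> v else \<psi> v))
        = (\<Prod>(u, v) \<in> E. b (\<phi> u) (\<phi> v))"
      using assms(2) by (intro prod.cong) auto
    moreover have "(\<Prod>(u, v) \<in> E'. b (if u \<in> V then \<phi> u else \<psi> u) (if v \<in> V then \<phi> v else \<psi> v))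
        = (\<Prod>(u, v) \<in> E'. b (\<psi> u) (\<psi> v))"
    proof (intro prod.cong refl)
      fix e assume "e \<in> E'"
      then have "fst e \<in> V'" "snd e \<in> V'" using assms(3) by auto
      then have "fst e \<notin> V" "snd e \<notin> V" using assms(1) by auto
      then show "(case e of (u, v) \<Rightarrow> b (if u \<in> V then \<phi> u else \<psi> u) (if v \<in> V then \<phi> v else \<psi> v))
          = (case e of (u, v) \<Rightarrow> b (\<psi> u) (\<psi> v))"
        by (simp add: case_prod_beta)
    qed
    ultimately show ?case using a fin disj by (simp add: prod.union_disjoint)
  qed
  finally show ?thesis by (simp add: hom_sum_def)
qed

lemma hom_sum_image:
  assumes "inj_on f V" "E \<subseteq> V \<times> V"
  shows "hom_sum n b (f ` V) (map_prod f f ` E) = hom_sum n b V E"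
  unfolding hom_sum_def
proof (rule sum.reindex_bij_witness[where
      i = "\<lambda>\<psi>. \<lambda>y \<in> f ` V. \<psi> (inv_into V f y)" and
      j = "\<lambda>\<phi>. \<lambda>x \<in> V. \<phi> (f x)"], goal_cases)
  case (5 \<phi>)
  have inj: "inj_on (map_prod f f) E"
    using map_prod_inj_on[OF assms(1) assms(1)] assms(2) by (rule inj_on_subset)
  show ?case
    unfolding prod.reindex[OF inj]
    using assms(2) by (intro prod.cong) auto
qed (use assms(1) in \<open>auto simp: PiE_def Pi_def extensional_def restrict_def fun_eq_iff inv_into_into\<close>)

section \<open>Walks, that is, entries of the matrix powers \<open>B^k\<close>\<close>

fun walk_weight :: "nat \<Rightarrow> (nat \<Rightarrow> nat \<Rightarrow> real) \<Rightarrow> nat \<Rightarrow> nat \<Rightarrow> nat \<Rightarrow> real" where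
  "walk_weight n b 0 x y = of_bool (x = y)"
| "walk_weight n b (Suc k) x y = (\<Sum>z<n. walk_weight n b k x z * b z y)"

lemma sum_of_bool_mult:
  fixes y n :: nat
  shows "y < n \<Longrightarrow> (\<Sum>z<n. f z * of_bool (z = y)) = (f y :: real)"
    "y < n \<Longrightarrow> (\<Sum>z<n. of_bool (y = z) * f z) = (f y :: real)"
  by (simp_all add: of_bool_def if_distrib[of "\<lambda>u. _ * u"] if_distrib[of "\<lambda>u. u * _"] sum.delta sum.delta' cong: if_cong)

lemma walk_weight_1: "x < n \<Longrightarrow> walk_weight n b (Suc 0) x y = b x y"
  by (simp add: sum_of_bool_mult)

lemma walk_weight_add:
  "y < n \<Longrightarrow> walk_weight n b (j + k) x y = (\<Sum>z<n. walk_weight n b j x z * walk_weight n b k z y)"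
proof (induction k arbitrary: y)
  case 0
  then show ?case by (simp add: sum_of_bool_mult)
next
  case (Suc k)
  have "walk_weight n b (j + Suc k) x y
      = (\<Sum>w<n. (\<Sum>z<n. walk_weight n b j x z * walk_weight n b k z w) * b w y)"
    using Suc.IH by simp
  also have "\<dots> = (\<Sum>z<n. walk_weight n b j x z * (\<Sum>w<n. walk_weight n b k z w * b w y))"
    unfolding sum_distrib_left sum_distrib_right by (subst sum.swap) (simp add: mult.assoc)
  finally show ?case by simp
qed

text \<open>The weight \<open>F\<close> of the two endpoints makes the induction go through, since
  the last arc is absorbed into it. Later \<open>F = 1\<close> gives paths, and the closing arc as
  \<open>F\<close> gives cycles.\<close>

lemma sum_walk:
  "(\<Sum>\<phi> \<in> {..k} \<rightarrow>\<^sub>E {..<n}. F (\<phi> 0) (\<phi> k) * (\<Prod>i<k. b (\<phi> i) (\<phi> (Suc i))))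
     = (\<Sum>x<n. \<Sum>y<n. F x y * walk_weight n b k x y)"
proof (induction k arbitrary: F)
  case 0
  have "(\<Sum>\<phi> \<in> {..0::nat} \<rightarrow>\<^sub>E {..<n}. F (\<phi> 0) (\<phi> 0)) = (\<Sum>x<n. F x x)"
    using sum_PiE_insert[where a = "0::nat" and S = "{}" and T = "\<lambda>_. {..<n}" and g = "\<lambda>\<phi>. F (\<phi> 0) (\<phi> 0)"]
    by (simp add: atMost_0)
  also have "\<dots> = (\<Sum>x<n. \<Sum>y<n. F x y * walk_weight n b 0 x y)"
    by (intro sum.cong) (auto simp: of_bool_def if_distrib[of "\<lambda>u. _ * u"] cong: if_cong)
  finally show ?case by simp
next
  case (Suc k)
  have "(\<Sum>\<phi> \<in> {..Suc k} \<rightarrow>\<^sub>E {..<n}. F (\<phi> 0) (\<phi> (Suc k)) * (\<Prod>i<Suc k. b (\<phi> i) (\<phi> (Suc i))))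
    = (\<Sum>y<n. \<Sum>\<psi> \<in> {..k} \<rightarrow>\<^sub>E {..<n}. F (\<psi> 0) y * b (\<psi> k) y * (\<Prod>i<k. b (\<psi> i) (\<psi> (Suc i))))"
    unfolding atMost_Suc
    by (subst sum_PiE_insert) (auto intro!: sum.cong prod.cong simp: mult_ac)
  also have "\<dots> = (\<Sum>y<n. \<Sum>x<n. \<Sum>z<n. F x y * b z y * walk_weight n b k x z)"
    by (intro sum.cong refl Suc.IH)
  also have "\<dots> = (\<Sum>x<n. \<Sum>y<n. F x y * walk_weight n b (Suc k) x y)"
    by (subst sum.swap) (simp add: sum_distrib_left mult_ac)
  finally show ?case .
qed

lemma prod_arcs: "(\<Prod>(u, v) \<in> (\<lambda>i. (i, g i)) ` I. f u v) = (\<Prod>i \<in> I. f i (g i))"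
  by (subst prod.reindex) (auto simp: inj_on_def)

text \<open>This is \<open>1^T B^k 1\<close>.\<close>

definition total_weight :: "nat \<Rightarrow> (nat \<Rightarrow> nat \<Rightarrow> real) \<Rightarrow> nat \<Rightarrow> real" where
  "total_weight n b k = (\<Sum>x<n. \<Sum>y<n. walk_weight n b k x y)"

lemma hom_sum_path: "hom_sum n b {..k} ((\<lambda>i. (i, Suc i)) ` {..<k}) = total_weight n b k"
  unfolding hom_sum_def prod_arcs total_weight_def
  using sum_walk[where F = "\<lambda>_ _. 1"] by simp

lemma hom_sum_cycle:
  assumes "0 < l"
  shows "hom_sum n b {..<l} ((\<lambda>i. (i, Suc i mod l)) ` {..<l}) = (\<Sum>x<n. walk_weight n b l x x)"
proof -
  obtain k where l: "l = Suc k" using assms gr0_implies_Suc by blast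
  have "hom_sum n b {..<l} ((\<lambda>i. (i, Suc i mod l)) ` {..<l})
    = (\<Sum>\<phi> \<in> {..k} \<rightarrow>\<^sub>E {..<n}. b (\<phi> k) (\<phi> 0) * (\<Prod>i<k. b (\<phi> i) (\<phi> (Suc i))))"
    unfolding hom_sum_def prod_arcs by (simp add: l lessThan_Suc_atMost lessThan_Suc[of k] del: lessThan_Suc)
      (simp add: l mult.commute flip: lessThan_Suc_atMost)
  also have "\<dots> = (\<Sum>x<n. \<Sum>y<n. walk_weight n b k x y * b y x)"
    using sum_walk[where F = "\<lambda>x y. b y x"] by (simp add: mult.commute)
  finally show ?thesis by (simp add: l)
qed

section \<open>Norms and traces for a skew-symmetric matrix\<close>

locale skew_kernel =
  fixes n :: nat and b :: "nat \<Rightarrow> nat \<Rightarrow> real"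
  assumes n_pos: "0 < n"
    and skew: "x < n \<Longrightarrow> y < n \<Longrightarrow> b y x = - b x y"
begin

abbreviation "W \<equiv> walk_weight n b"

text \<open>Transposing gives \<open>(B^k)^T = (-B)^k\<close>. The induction peels the first arc of
  one walk and the last arc of the other.\<close>

lemma walk_weight_skew: "x < n \<Longrightarrow> y < n \<Longrightarrow> W k y x = (- 1) ^ k * W k x y"
proof (induction k arbitrary: x y)
  case (Suc k)
  have "W (Suc k) y x = (\<Sum>z<n. (- 1) ^ k * W k z y * - b x z)"
    using Suc.IH[of _ y] Suc.prems skew[of x] by (auto intro!: sum.cong simp del: mult_minus_right)
  also have "\<dots> = (- 1) ^ Suc k * (\<Sum>z<n. W (Suc 0) x z * W k z y)"
    using Suc.prems by (simp add: walk_weight_1 sum_distrib_left mult_ac del: walk_weight.simps(2))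
  also have "(\<Sum>z<n. W (Suc 0) x z * W k z y) = W (Suc k) x y"
    using walk_weight_add[of y n b "Suc 0" k x] Suc.prems by (simp del: walk_weight.simps(2))
  finally show ?case .
qed auto

lemma total_weight_odd: 
  assumes "odd k" shows "total_weight n b k = 0"
proof -
  have "total_weight n b k = (\<Sum>x<n. \<Sum>y<n. - W k y x)"
    unfolding total_weight_def
  proof (intro sum.cong refl)
    fix x y assume "x \<in> {..<n}" "y \<in> {..<n}"
    then show "W k x y = - W k y x" using walk_weight_skew[of x y k] assms by simp
  qed
  also have "\<dots> = - total_weight n b k"
    unfolding total_weight_def sum_negf by (subst sum.swap) simp
  finally show ?thesis by simp
qed

text \<open>The vector \<open>B^k 1\<close>; \<open>row_norm\<close> below is its squared Euclidean
  length.\<close>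

definition row_weight :: "nat \<Rightarrow> nat \<Rightarrow> real" where
  "row_weight k x = (\<Sum>y<n. W k x y)"

text \<open>The inner product of \<open>B^j 1\<close> and \<open>B^k 1\<close> is
  \<open>1^T (B^T)^j B^k 1\<close>, and \<open>B^T = -B\<close>.\<close>

lemma sum_row_weight_mult:
  "(\<Sum>x<n. row_weight j x * row_weight k x) = (- 1) ^ j * total_weight n b (j + k)"
proof -
  have "(\<Sum>x<n. row_weight j x * row_weight k x) = (\<Sum>x<n. \<Sum>y<n. \<Sum>z<n. (- 1) ^ j * W j y x * W k x z)"
    unfolding row_weight_def sum_product
  proof (intro sum.cong refl)
    fix x y z assume "x \<in> {..<n}" "y \<in> {..<n}" "z \<in> {..<n}"
    then show "W j x y * W k x z = (- 1) ^ j * W j y x * W k x z"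
      using walk_weight_skew[of y x j] by simp
  qed
  also have "\<dots> = (\<Sum>y<n. \<Sum>z<n. \<Sum>x<n. (- 1) ^ j * W j y x * W k x z)"
    by (rule trans[OF sum.swap], rule sum.cong[OF refl], rule sum.swap)
  also have "\<dots> = (- 1) ^ j * total_weight n b (j + k)"
    unfolding total_weight_def
    by (simp add: walk_weight_add sum_distrib_left mult.assoc cong: sum.cong_simp)
  finally show ?thesis .
qed

definition row_norm :: "nat \<Rightarrow> real" where
  "row_norm m = (\<Sum>x<n. (row_weight m x)\<^sup>2)"

lemma row_norm_nonneg: "0 \<le> row_norm m"
  by (simp add: row_norm_def sum_nonneg)

lemma total_weight_even: "total_weight n b (2 * m) = (- 1) ^ m * row_norm m"
  using sum_row_weight_mult[of m m]
  by (simp add: row_norm_def power2_eq_square mult_2[symmetric] mult.assoc[symmetric] power_add[symmetric])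

text \<open>Cauchy-Schwarz for \<open>B^m 1\<close> and \<open>B^(m+2) 1\<close>: by skew symmetry
  their inner product is minus the squared length of \<open>B^(m+1) 1\<close>.\<close>

lemma row_norm_log_convex: "(row_norm (Suc m))\<^sup>2 \<le> row_norm m * row_norm (Suc (Suc m))"
proof -
  have "(\<Sum>x<n. row_weight m x * row_weight (Suc (Suc m)) x) = - row_norm (Suc m)"
    using sum_row_weight_mult[of m "Suc (Suc m)"] total_weight_even[of "Suc m"]
    by (simp add: mult.assoc[symmetric] power_add[symmetric] mult_2)
  then show ?thesis
    using Cauchy_Schwarz_ineq_sum[of "row_weight m" "row_weight (Suc (Suc m))" "{..<n}"]
    by (simp add: row_norm_def)
qed

lemma row_norm_0: "row_norm 0 = real n"
  by (simp add: row_norm_def row_weight_def of_bool_def)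

lemma closed_walks_odd:
  assumes "odd l" shows "(\<Sum>x<n. W l x x) = 0"
proof -
  have "W l x x = 0" if "x < n" for x
    using walk_weight_skew[OF that that, of l] assms by simp
  then show ?thesis by simp
qed

text \<open>The trace of \<open>B^m B^m\<close> is, up to the sign from transposing one factor, the
  squared Frobenius norm of \<open>B^m\<close>. This fixes the sign of the full cycle term.\<close>

lemma closed_walks_even:
  "(\<Sum>x<n. W (2 * m) x x) = (- 1) ^ m * (\<Sum>x<n. \<Sum>y<n. (W m x y)\<^sup>2)"
proof -
  have "W (2 * m) x x = (- 1) ^ m * (\<Sum>y<n. (W m x y)\<^sup>2)" if x: "x < n" for x
    unfolding mult_2 walk_weight_add[OF x] sum_distrib_left
  proof (intro sum.cong refl)
    fix y assume "y \<in> {..<n}"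
    then show "W m x y * W m y x = (- 1) ^ m * (W m x y)\<^sup>2"
      using walk_weight_skew[of x y m] x by (simp add: power2_eq_square)
  qed
  then show ?thesis by (simp add: sum_distrib_left)
qed

end

section \<open>Spectral radius and path densities\<close>

text \<open>Log-convexity makes successive ratios nondecreasing, so a single ratio above
  \<open>\<rho>\<close> would force growth faster than the assumed rate. In this way an asymptotic
  bound becomes a bound at every step, with no diagonalisation of \<open>B\<close>.\<close>

lemma log_convex_growth:
  fixes a :: "nat \<Rightarrow> real"
  assumes nonneg: "\<And>m. 0 \<le> a m" and convex: "\<And>m. (a (Suc m))\<^sup>2 \<le> a m * a (Suc (Suc m))"
    and "0 \<le> \<rho>" and growth: "\<And>r. \<rho> < r \<Longrightarrow> \<exists>C. \<forall>m. a m \<le> C * r ^ m"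
  shows "a (Suc m) \<le> \<rho> * a m"
proof (rule ccontr)
  assume *: "\<not> a (Suc m) \<le> \<rho> * a m"
  \<comment> \<open>If \<open>a m = 0\<close>, then convexity gives \<open>a (Suc m) = 0\<close> and
    the claim holds.\<close>
  have pos: "0 < a m"
    using * convex[of m] nonneg[of m] by (cases "a m = 0") auto
  define r where "r = a (Suc m) / a m"
  have r: "\<rho> < r" "0 < r" proof -
    show "\<rho> < r" using * pos by (simp add: r_def pos_less_divide_eq)
    then show "0 < r" using \<open>0 \<le> \<rho>\<close> by simp
  qed
  \<comment> \<open>Positivity is carried along so that \<open>a (m + j)\<close> can be cancelled in
    the convexity inequality.\<close>
  have ratio: "r * a (m + j) \<le> a (Suc (m + j)) \<and> 0 < a (m + j)" for j
  proof (induction j)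
    case 0
    then show ?case using pos by (simp add: r_def)
  next
    case (Suc j)
    then have p: "0 < a (Suc (m + j))" using r(2)
      by (meson less_le_trans mult_pos_pos)
    have "r * a (m + j) * a (Suc (m + j)) \<le> a (Suc (m + j)) * a (Suc (m + j))"
      using Suc p by (intro mult_right_mono) auto
    also have "\<dots> \<le> a (m + j) * a (Suc (Suc (m + j)))"
      using convex[of "m + j"] by (simp add: power2_eq_square)
    finally have "a (m + j) * (r * a (Suc (m + j))) \<le> a (m + j) * a (Suc (Suc (m + j)))"
      by (simp add: mult_ac)
    then show ?case using Suc p by simp
  qed
  have lower: "r ^ j * a m \<le> a (m + j)" for j
  proof (induction j)
    case (Suc j)
    have "r ^ Suc j * a m \<le> r * a (m + j)" using Suc r(2) by (simp add: mult.assoc)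
    also have "\<dots> \<le> a (m + Suc j)" using ratio[of j] by simp
    finally show ?case .
  qed simp
  \<comment> \<open>At a rate \<open>s\<close> strictly between \<open>\<rho>\<close> and
    \<open>r\<close> the upper bound applies, while the lower bound \<open>r ^ j\<close> outgrows
    it.\<close>
  obtain s where s: "\<rho> < s" "s < r" using r(1) dense by blast
  obtain C where C: "\<And>m. a m \<le> C * s ^ m" using growth[OF s(1)] by blast
  have "1 < r / s" using s \<open>0 \<le> \<rho>\<close> by simp
  then obtain j where j: "C * s ^ m / a m < (r / s) ^ j" using real_arch_pow by blast
  have "r ^ j * a m \<le> C * s ^ (m + j)" using lower C order_trans by blast
  then have "(r / s) ^ j \<le> C * s ^ m / a m"
    using pos s \<open>0 \<le> \<rho>\<close> by (simp add: power_divide power_add field_simps)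
  with j show False by simp
qed

lemma spectral_radius_nonneg:
  "A \<in> carrier_mat n n \<Longrightarrow> 0 < n \<Longrightarrow> 0 \<le> spectral_radius A"
  using spectral_radius_mem_max(1)[of A n] by (metis imageE norm_ge_zero)

text \<open>An eigenvector of the scaled matrix for \<open>\<mu>\<close> is one of the original
  matrix for \<open>\<mu> / c\<close>.\<close>

lemma spectral_radius_smult_le:
  assumes A: "A \<in> carrier_mat n n" and "0 < n" "0 < c"
  shows "spectral_radius (complex_of_real c \<cdot>\<^sub>m A) \<le> c * spectral_radius A"
proof -
  let ?B = "complex_of_real c \<cdot>\<^sub>m A"
  have B: "?B \<in> carrier_mat n n" using A by simp
  obtain \<mu> where \<mu>: "eigenvalue ?B \<mu>" "spectral_radius ?B = norm \<mu>"
    using spectral_radius_mem_max(1)[OF B \<open>0 < n\<close>] by (auto simp: spectrum_def)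
  then obtain v where v: "v \<in> carrier_vec n" "v \<noteq> 0\<^sub>v n" "?B *\<^sub>v v = \<mu> \<cdot>\<^sub>v v"
    using A by (auto simp: eigenvalue_def eigenvector_def)
  have "A *\<^sub>v v = (\<mu> / of_real c) \<cdot>\<^sub>v v"
  proof (intro eq_vecI)
    fix i assume i: "i < dim_vec ((\<mu> / of_real c) \<cdot>\<^sub>v v)"
    have "(?B *\<^sub>v v) $ i = (\<mu> \<cdot>\<^sub>v v) $ i" using v(3) by simp
    then have "of_real c * (A *\<^sub>v v) $ i = \<mu> * v $ i"
      using i v(1) A by simp
    then show "(A *\<^sub>v v) $ i = ((\<mu> / of_real c) \<cdot>\<^sub>v v) $ i"
      using i \<open>0 < c\<close> by (simp add: field_simps)
  qed (use A v in auto)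
  then have "eigenvalue A (\<mu> / of_real c)"
    using v A by (auto simp: eigenvalue_def eigenvector_def)
  then have "norm (\<mu> / of_real c) \<le> spectral_radius A"
    using spectral_radius_mem_max(2)[OF A \<open>0 < n\<close>] by (auto simp: spectrum_def)
  then show ?thesis using \<mu> \<open>0 < c\<close> by (simp add: norm_divide field_simps)
qed

lemma walk_weight_pow_mat:
  assumes "x < n" "y < n"
  shows "((complex_of_real c \<cdot>\<^sub>m mat n n (\<lambda>(x, y). complex_of_real (b x y))) ^\<^sub>m k) $$ (x, y)
    = complex_of_real (c ^ k * walk_weight n b k x y)"
  using assms
proof (induction k arbitrary: y)
  case (Suc k)
  then show ?case
    by (simp add: scalar_prod_def sum_distrib_left atLeast0LessThan mult_ac)
qed simp

definition kernel_radius :: "nat \<Rightarrow> (nat \<Rightarrow> nat \<Rightarrow> real) \<Rightarrow> real" where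
  "kernel_radius n b = spectral_radius (mat n n (\<lambda>(x, y). complex_of_real (b x y)))"

context skew_kernel
begin

lemma kernel_radius_nonneg: "0 \<le> kernel_radius n b"
  unfolding kernel_radius_def by (rule spectral_radius_nonneg[of _ n]) (auto simp: n_pos)

text \<open>Dividing by \<open>r\<close> brings the spectral radius below 1, where the Jordan normal
  form bounds all powers entrywise by a constant.\<close>

lemma walk_weight_growth:
  assumes "kernel_radius n b < r"
  shows "\<exists>C. \<forall>k. \<forall>x<n. \<forall>y<n. \<bar>W k x y\<bar> \<le> C * r ^ k"
proof -
  let ?A = "mat n n (\<lambda>(x, y). complex_of_real (b x y))"
  have r: "0 < r" using assms kernel_radius_nonneg by simp
  have "spectral_radius (complex_of_real (1 / r) \<cdot>\<^sub>m ?A) \<le> 1 / r * kernel_radius n b"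
    unfolding kernel_radius_def by (rule spectral_radius_smult_le[of _ n]) (auto simp: n_pos r)
  also have "\<dots> < 1" using assms r by simp
  finally have less: "spectral_radius (complex_of_real (1 / r) \<cdot>\<^sub>m ?A) < 1" .
  have carrier: "complex_of_real (1 / r) \<cdot>\<^sub>m ?A \<in> carrier_mat n n" by simp
  obtain C where C: "\<And>k. norm_bound ((complex_of_real (1 / r) \<cdot>\<^sub>m ?A) ^\<^sub>m k) C"
    using spectral_radius_jnf_norm_bound_less_1_upper_triangular[OF carrier less] by blast
  have "\<bar>W k x y\<bar> \<le> C * r ^ k" if xy: "x < n" "y < n" for k x y
  proof -
    have "norm (((complex_of_real (1 / r) \<cdot>\<^sub>m ?A) ^\<^sub>m k) $$ (x, y)) \<le> C"
      using C[of k, unfolded norm_bound_def, rule_format, of x y] xy by (simp only: pow_mat_dim_square[OF carrier])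
    then have "\<bar>(1 / r) ^ k * W k x y\<bar> \<le> C"
      unfolding walk_weight_pow_mat[OF xy] norm_of_real .
    then have "(1 / r) ^ k * \<bar>W k x y\<bar> \<le> C" using r by (simp add: abs_mult)
    then show ?thesis using r by (simp add: power_divide divide_le_eq)
  qed
  then show ?thesis by blast
qed

text \<open>For any \<open>r\<close> above the squared radius, the entries of \<open>B^k\<close> are
  at most a constant times \<open>sqrt r ^ k\<close>, hence \<open>row_norm k\<close> is at most a
  constant times \<open>r ^ k\<close>. Log-convexity turns this into a one-step inequality.\<close>

lemma row_norm_Suc_le: "row_norm (Suc m) \<le> (kernel_radius n b)\<^sup>2 * row_norm m"
proof (rule log_convex_growth)
  fix r assume r: "(kernel_radius n b)\<^sup>2 < r"
  then have sr: "kernel_radius n b < sqrt r" using real_less_rsqrt by blast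
  have r0: "0 < r" using r by (meson le_less_trans zero_le_power2)
  obtain C where C: "\<And>k x y. x < n \<Longrightarrow> y < n \<Longrightarrow> \<bar>W k x y\<bar> \<le> C * sqrt r ^ k"
    using walk_weight_growth[OF sr] by blast
  have "row_norm k \<le> (real n * (real n * C)\<^sup>2) * r ^ k" for k
  proof -
    have "(row_weight k x)\<^sup>2 \<le> (real n * C)\<^sup>2 * r ^ k" if "x < n" for x
    proof -
      have "\<bar>row_weight k x\<bar> \<le> (\<Sum>y<n. \<bar>W k x y\<bar>)" unfolding row_weight_def by (rule sum_abs)
      also have "\<dots> \<le> (\<Sum>y<n. C * sqrt r ^ k)" using C that by (intro sum_mono) auto
      finally have "\<bar>row_weight k x\<bar> \<le> real n * C * sqrt r ^ k" by (simp add: mult.assoc)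
      then have "\<bar>row_weight k x\<bar>\<^sup>2 \<le> (real n * C * sqrt r ^ k)\<^sup>2" by (rule power_mono) simp
      also have "\<dots> = (real n * C)\<^sup>2 * (sqrt r ^ 2) ^ k"
        by (simp add: power_mult_distrib flip: power_mult) (simp add: mult.commute)
      finally show ?thesis using r0 by simp
    qed
    then have "row_norm k \<le> (\<Sum>x<n. (real n * C)\<^sup>2 * r ^ k)"
      unfolding row_norm_def by (intro sum_mono) auto
    then show ?thesis by (simp add: mult.assoc)
  qed
  then show "\<exists>C. \<forall>m. row_norm m \<le> C * r ^ m" by blast
qed (auto simp: row_norm_nonneg row_norm_log_convex)

text \<open>The quantity \<open>a_m\<close>. The exponent \<open>2 * m + 1\<close> is the number of
  vertices of a path with \<open>2 * m\<close> edges.\<close>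

definition path_density :: "nat \<Rightarrow> real" where
  "path_density m = row_norm m / real n ^ (2 * m + 1)"

lemma path_density_nonneg: "0 \<le> path_density m"
  by (simp add: path_density_def row_norm_nonneg)

lemma path_density_0: "path_density 0 = 1"
  using n_pos by (simp add: path_density_def row_norm_0)

lemma total_weight_density:
  "total_weight n b k / real n ^ Suc k
    = (if even k then (- 1) ^ (k div 2) * path_density (k div 2) else 0)"
  by (auto simp: total_weight_odd path_density_def total_weight_even elim!: evenE)

text \<open>Log-convexity at \<open>m = 0\<close>, where the vector is \<open>1\<close> and its
  squared length is \<open>n\<close>.\<close>

lemma path_density_1_square_le: "(path_density 1)\<^sup>2 \<le> path_density 2"
proof -
  have "(row_norm 1)\<^sup>2 \<le> real n * row_norm 2"
    using row_norm_log_convex[of 0] by (simp add: row_norm_0 numeral_2_eq_2)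
  then have "(row_norm 1)\<^sup>2 / real n ^ 6 \<le> real n * row_norm 2 / real n ^ 6"
    by (intro divide_right_mono) auto
  then show ?thesis using n_pos
    by (simp add: path_density_def power_divide eval_nat_numeral)
qed

lemma path_density_Suc_le:
  assumes "kernel_radius n b \<le> \<eta> * real n"
  shows "path_density (Suc m) \<le> \<eta>\<^sup>2 * path_density m"
proof -
  have "row_norm (Suc m) \<le> (\<eta> * real n)\<^sup>2 * row_norm m"
    using row_norm_Suc_le[of m] assms kernel_radius_nonneg row_norm_nonneg[of m]
    by (meson mult_right_mono order_trans power_mono)
  then have "path_density (Suc m) \<le> (\<eta> * real n)\<^sup>2 * row_norm m / real n ^ (2 * Suc m + 1)"
    unfolding path_density_def by (intro divide_right_mono) auto
  also have "\<dots> = \<eta>\<^sup>2 * path_density m"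
    using n_pos by (simp add: path_density_def power_mult_distrib power2_eq_square field_simps)
  finally show ?thesis .
qed

end

section \<open>Edge sets of a cycle\<close>

text \<open>Edge \<open>j\<close> of the cycle joins \<open>j\<close> to its successor, so the same
  notation serves for edges and vertices: the path with edges \<open>run l i k\<close> has vertices
  \<open>run l i (Suc k)\<close>.\<close>

definition run :: "nat \<Rightarrow> nat \<Rightarrow> nat \<Rightarrow> nat set" where
  "run l i k = (\<lambda>j. (i + j) mod l) ` {..<k}"

definition cycle_arcs :: "nat \<Rightarrow> nat set \<Rightarrow> nat rel" where
  "cycle_arcs l S = (\<lambda>i. (i, Suc i mod l)) ` S"

text \<open>Here \<open>V\<close> holds vertices and \<open>S\<close> holds edges: no edge of
  \<open>S\<close> has an end in \<open>V\<close>.\<close>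

definition apart :: "nat \<Rightarrow> nat set \<Rightarrow> nat set \<Rightarrow> bool" where
  "apart l V S \<longleftrightarrow> (\<forall>j \<in> S. j \<notin> V \<and> Suc j mod l \<notin> V)"

lemma Suc_mod_cancel: "Suc x mod l = Suc y mod l \<Longrightarrow> x mod l = y mod l"
  by (auto simp: mod_Suc split: if_splits)

lemma inj_on_rotate: "inj_on (\<lambda>j. (i + j) mod l) {..<l :: nat}"
proof (rule inj_onI)
  fix x y assume "x \<in> {..<l}" "y \<in> {..<l}" "(i + x) mod l = (i + y) mod l"
  moreover have "(i + x) mod l = (i + y) mod l \<Longrightarrow> x mod l = y mod l"
  proof (induction i)
    case (Suc i)
    then show ?case using Suc_mod_cancel[of "i + x" l "i + y"] by simp
  qed simp
  ultimately show "x = y" by simp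
qed

lemma card_run: "k \<le> l \<Longrightarrow> card (run l i k) = k"
  unfolding run_def
  by (subst card_image) (auto intro: inj_on_subset[OF inj_on_rotate])

lemma run_subset: "0 < l \<Longrightarrow> run l i k \<subseteq> {..<l}"
  by (auto simp: run_def)

lemma finite_run: "finite (run l i k)"
  by (simp add: run_def)

lemma run_Suc: "run l i (Suc k) = insert ((i + k) mod l) (run l i k)"
  by (simp add: run_def lessThan_Suc)

lemma mem_run: "j < k \<Longrightarrow> (i + j) mod l \<in> run l i k"
  by (simp add: run_def)

text \<open>Starting at a missing edge, go clockwise to the first edge of \<open>S\<close>, then on
  to the next gap. What is passed in between is a maximal run, which therefore shares no vertex with
  the other edges.\<close>

lemma ex_run_apart:
  assumes S: "S \<subseteq> {..<l}" "S \<noteq> {}" "S \<noteq> {..<l}"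
  obtains i k S' where "i < l" "0 < k" "k < l" "S = run l i k \<union> S'" "run l i k \<inter> S' = {}"
    "apart l (run l i (Suc k)) S'"
proof -
  obtain a where a: "a < l" "a \<notin> S" using S by auto
  obtain s where s: "s \<in> S" "s < l" using S by auto
  \<comment> \<open>The distance from the missing edge \<open>a\<close> to the first edge of
    \<open>S\<close>; minimality later shows that the edge just before the run is absent.\<close>
  define d where "d = (LEAST d. (a + d) mod l \<in> S)"
  have "(a + (s + l - a)) mod l \<in> S" using a s by simp
  then have d: "(a + d) mod l \<in> S" unfolding d_def by (rule LeastI)
  have d_min: "(a + j) mod l \<notin> S" if "j < d" for j
    using that not_less_Least unfolding d_def by blast
  have "0 < d" using d a by (cases d) auto
  have "d < l"
  proof (rule ccontr)
    assume "\<not> d < l"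
    then have "(a + (d - l)) mod l = (a + d) mod l"
      by (metis Nat.add_diff_assoc le_mod_geq not_less trans_le_add2)
    with d d_min[of "d - l"] a \<open>\<not> d < l\<close> show False by auto
  qed
  define i where "i = (a + d) mod l"
  define k where "k = (LEAST k. (i + k) mod l \<notin> S)"
  \<comment> \<open>After \<open>l - d\<close> further steps from \<open>i\<close> one is back at
    the missing edge \<open>a\<close>, so the run has length at most
    \<open>l - d < l\<close>.\<close>
  have "(i + (l - d)) mod l = (a + d + (l - d)) mod l" unfolding i_def by (rule mod_add_left_eq)
  also have "\<dots> = a" using \<open>d < l\<close> a by simp
  finally have "(i + (l - d)) mod l = a" .
  then have ex: "(i + (l - d)) mod l \<notin> S" using a by simp
  have k: "(i + k) mod l \<notin> S" unfolding k_def using ex by (rule LeastI)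
  have k_min: "(i + j) mod l \<in> S" if "j < k" for j
    using that not_less_Least unfolding k_def by blast
  have "k \<le> l - d" unfolding k_def using ex by (rule Least_le)
  have "i < l" "i \<in> S" using a d by (auto simp: i_def)
  have "0 < k" using k \<open>i \<in> S\<close> \<open>i < l\<close> by (cases k) auto
  have sub: "run l i k \<subseteq> S" using k_min by (auto simp: run_def)
  have "apart l (run l i (Suc k)) (S - run l i k)"
    unfolding apart_def
  proof (intro ballI conjI)
    fix j assume j: "j \<in> S - run l i k"
    then have jl: "j < l" using S by auto
    show "j \<notin> run l i (Suc k)" using j k by (auto simp: run_Suc)
    show "Suc j mod l \<notin> run l i (Suc k)"
    proof
      assume "Suc j mod l \<in> run l i (Suc k)"
      then obtain m where m: "m < Suc k" "Suc j mod l = (i + m) mod l" by (auto simp: run_def)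
      show False
      \<comment> \<open>If \<open>j\<close> ends at the first vertex of the run, it is the edge just
        before the run, which is not in \<open>S\<close>; if it ends at a later vertex, it is an
        edge of the run itself.\<close>
      proof (cases m)
        case 0
        have "Suc j mod l = (a + d) mod l"
          using m 0 by (simp add: i_def)
        then have "Suc j mod l = Suc (a + (d - 1)) mod l" using \<open>0 < d\<close> by simp
        then have "j = (a + (d - 1)) mod l" using Suc_mod_cancel[of j l "a + (d - 1)"] jl by simp
        then show False using d_min[of "d - 1"] j \<open>0 < d\<close> by auto
      next
        case (Suc m')
        then have "Suc j mod l = Suc (i + m') mod l" using m by simp
        then have "j = (i + m') mod l" using Suc_mod_cancel[of j l "i + m'"] jl by simp
        then show False using mem_run[of m' k i l] m Suc j by auto
      qed
    qed
  qed
  moreover have "k < l" "S = run l i k \<union> (S - run l i k)"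
    using \<open>k \<le> l - d\<close> \<open>0 < d\<close> a sub by auto
  ultimately show thesis
    using that[of i k "S - run l i k"] \<open>i < l\<close> \<open>0 < k\<close> by blast
qed

lemma cycle_arcs_run:
  "cycle_arcs l (run l i k) = map_prod (\<lambda>j. (i + j) mod l) (\<lambda>j. (i + j) mod l) ` (\<lambda>j. (j, Suc j)) ` {..<k}"
  by (auto simp: cycle_arcs_def run_def image_image mod_Suc_eq)

section \<open>Densities of edge sets of the cycle\<close>

context skew_kernel
begin

definition \<tau> :: "nat \<Rightarrow> nat set \<Rightarrow> real" where
  "\<tau> l S = hom_sum n b {..<l} (cycle_arcs l S) / real n ^ l"

lemma \<tau>_empty: "\<tau> l {} = 1"
  using n_pos by (simp add: \<tau>_def cycle_arcs_def hom_sum_no_arcs)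

text \<open>The \<open>k + 1\<close> vertices of the run and the remaining vertices carry disjoint
  sets of arcs, so the sum factorises. Deleting the arcs of the run leaves its vertices free, whence
  the power of \<open>n\<close>.\<close>

lemma \<tau>_run_Un:
  assumes "i < l" "k < l" "S \<subseteq> {..<l}" "apart l (run l i (Suc k)) S"
  shows "\<tau> l (run l i k \<union> S) = total_weight n b k / real n ^ Suc k * \<tau> l S"
proof -
  let ?V = "run l i (Suc k)" and ?V' = "{..<l} - run l i (Suc k)"
  have V: "?V \<union> ?V' = {..<l}" "?V \<inter> ?V' = {}" "finite ?V" "finite ?V'"
    using assms run_subset[of l i "Suc k"] by (auto simp: finite_run)
  have V_eq: "?V = (\<lambda>j. (i + j) mod l) ` {..k}" by (simp add: run_def lessThan_Suc_atMost)
  have inj: "inj_on (\<lambda>j. (i + j) mod l) {..k}"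
    by (rule inj_on_subset[OF inj_on_rotate]) (use assms in auto)
  have path: "hom_sum n b ?V (cycle_arcs l (run l i k)) = total_weight n b k"
    unfolding V_eq cycle_arcs_run
    by (subst hom_sum_image[OF inj]) (auto simp: hom_sum_path)
  have E: "cycle_arcs l (run l i k) \<subseteq> ?V \<times> ?V"
    unfolding V_eq cycle_arcs_run by auto
  have E': "cycle_arcs l S \<subseteq> ?V' \<times> ?V'"
    using assms by (auto simp: cycle_arcs_def apart_def)
  have 1: "hom_sum n b {..<l} (cycle_arcs l (run l i k \<union> S))
      = total_weight n b k * hom_sum n b ?V' (cycle_arcs l S)"
    using hom_sum_Un[OF V(2) E E' V(3,4), of n b] path V(1)
    by (simp add: cycle_arcs_def image_Un)
  have 2: "hom_sum n b {..<l} (cycle_arcs l S) = real n ^ Suc k * hom_sum n b ?V' (cycle_arcs l S)"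
    using hom_sum_Un[of ?V ?V' "{}" "cycle_arcs l S" n b] V E' assms card_run[of "Suc k" l i]
    by (simp add: hom_sum_no_arcs)
  show ?thesis using n_pos unfolding \<tau>_def 1 2 by (simp add: field_simps)
qed

lemma \<tau>_run_Un_even:
  assumes "i < l" "2 * m < l" "S \<subseteq> {..<l}" "apart l (run l i (Suc (2 * m))) S"
  shows "\<tau> l (run l i (2 * m) \<union> S) = (- 1) ^ m * path_density m * \<tau> l S"
  unfolding \<tau>_run_Un[OF assms] total_weight_density by simp

lemma \<tau>_run_Un_odd:
  assumes "i < l" "k < l" "S \<subseteq> {..<l}" "apart l (run l i (Suc k)) S" "odd k"
  shows "\<tau> l (run l i k \<union> S) = 0"
  unfolding \<tau>_run_Un[OF assms(1-4)] total_weight_density using assms(5) by simp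

text \<open>The peeling step for all later inductions: a maximal run of odd length would make the
  density vanish, so its length is some \<open>2 * m\<close>, and the rest is again a proper
  subset.\<close>

lemma \<tau>_even_run:
  assumes "S \<subseteq> {..<l}" "S \<noteq> {}" "S \<noteq> {..<l}" "\<tau> l S \<noteq> 0"
  shows "\<exists>i m S'. i < l \<and> 0 < m \<and> 2 * m < l \<and> S = run l i (2 * m) \<union> S' \<and>
    S' \<subseteq> {..<l} \<and> S' \<noteq> {..<l} \<and> card S = 2 * m + card S' \<and>
    apart l (run l i (Suc (2 * m))) S' \<and> \<tau> l S = (- 1) ^ m * path_density m * \<tau> l S'"
proof -
  obtain i k S' where *: "i < l" "0 < k" "k < l" "S = run l i k \<union> S'" "run l i k \<inter> S' = {}"
    "apart l (run l i (Suc k)) S'"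
    using ex_run_apart[OF assms(1-3)] by blast
  have S': "S' \<subseteq> {..<l}" using * assms(1) by auto
  have "even k" using \<tau>_run_Un_odd[of i l k S'] * S' assms(4) by auto
  then obtain m where m: "k = 2 * m" by (elim evenE)
  have "card S = k + card S'"
    unfolding *(4) using * S' finite_subset[OF S'] card_run[of k l i]
    by (subst card_Un_disjoint) (auto simp: finite_run)
  moreover have "S' \<noteq> {..<l}" using *(5) mem_run[of 0 k i l] *(1,2) by auto
  ultimately show ?thesis
    using * m S' \<tau>_run_Un_even[of i l m S']
    by (intro exI[of _ i] exI[of _ m] exI[of _ S']) simp
qed

text \<open>Peeling off runs of even length preserves the parity of the number of edges, so an odd
  set can never be exhausted.\<close>

lemma \<tau>_odd:
  assumes "S \<subseteq> {..<l}" "S \<noteq> {..<l}" "odd (card S)"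
  shows "\<tau> l S = 0"
  using assms
proof (induction "card S" arbitrary: S rule: less_induct)
  case less
  show ?case
  proof (rule ccontr)
    assume nz: "\<tau> l S \<noteq> 0"
    have "S \<noteq> {}" using less.prems by auto
    then obtain m S' where "0 < m" "S' \<subseteq> {..<l}" "S' \<noteq> {..<l}" "card S = 2 * m + card S'"
      "\<tau> l S = (- 1) ^ m * path_density m * \<tau> l S'"
      using \<tau>_even_run[OF less.prems(1) _ less.prems(2) nz] by blast
    moreover from this have "\<tau> l S' = 0" using less.hyps[of S'] less.prems by auto
    ultimately show False using \<open>\<tau> l S \<noteq> 0\<close> by simp
  qed
qed

lemma path_density_le:
  assumes "kernel_radius n b \<le> \<eta> * real n"
  shows "path_density (m + k) \<le> (\<eta>\<^sup>2) ^ m * path_density k"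
proof (induction m)
  case (Suc m)
  have "path_density (Suc m + k) \<le> \<eta>\<^sup>2 * path_density (m + k)"
    using path_density_Suc_le[OF assms] by simp
  also have "\<dots> \<le> \<eta>\<^sup>2 * ((\<eta>\<^sup>2) ^ m * path_density k)"
    using Suc by (intro mult_left_mono) auto
  finally show ?case by (simp add: mult.assoc)
qed simp

text \<open>Each run with \<open>2 * m\<close> edges contributes at most
  \<open>\<eta> ^ (2 * m)\<close>, because \<open>a_0 = 1\<close>.\<close>

lemma abs_\<tau>_le_power:
  assumes "S \<subseteq> {..<l}" "S \<noteq> {..<l}" "kernel_radius n b \<le> \<eta> * real n" "0 \<le> \<eta>"
  shows "\<bar>\<tau> l S\<bar> \<le> \<eta> ^ card S"
  using assms(1,2)
proof (induction "card S" arbitrary: S rule: less_induct)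
  case less
  show ?case
  proof (cases "S = {} \<or> \<tau> l S = 0")
    case True
    then show ?thesis using \<open>0 \<le> \<eta>\<close> by (auto simp: \<tau>_empty)
  next
    case False
    then obtain m S' where *: "0 < m" "S' \<subseteq> {..<l}" "S' \<noteq> {..<l}" "card S = 2 * m + card S'"
      "\<tau> l S = (- 1) ^ m * path_density m * \<tau> l S'"
      using \<tau>_even_run[of S l] less.prems by blast
    have "\<bar>\<tau> l S'\<bar> \<le> \<eta> ^ card S'" using * less.hyps[of S'] by simp
    moreover have "path_density m \<le> \<eta> ^ (2 * m)"
      using path_density_le[OF assms(3), of m 0] by (simp add: path_density_0 power_mult)
    ultimately have "path_density m * \<bar>\<tau> l S'\<bar> \<le> \<eta> ^ (2 * m) * \<eta> ^ card S'"
      using \<open>0 \<le> \<eta>\<close> by (intro mult_mono) (auto simp: path_density_nonneg)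
    then show ?thesis
      using * by (simp add: abs_mult power_abs path_density_nonneg power_add)
  qed
qed

text \<open>This makes larger sets negligible against \<open>a_2\<close>. A run with six or more
  edges already gives \<open>\<eta> * a_2\<close>. A run with four edges gives \<open>a_2\<close>,
  and the rest is nonempty and gives \<open>\<eta>\<close>. If the first run has two edges, a second
  one is peeled off: two such runs give \<open>a_1^2 \<le> a_2\<close>, and a fifth edge supplies
  \<open>\<eta>\<close>.\<close>

lemma abs_\<tau>_le:
  assumes S: "S \<subseteq> {..<l}" "S \<noteq> {..<l}" "5 \<le> card S"
    and r: "kernel_radius n b \<le> \<eta> * real n" "0 \<le> \<eta>" "\<eta> \<le> 1"
  shows "\<bar>\<tau> l S\<bar> \<le> \<eta> * path_density 2"
proof (cases "\<tau> l S = 0")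
  case True
  then show ?thesis using r by (simp add: path_density_nonneg)
next
  case False
  have le_1: "\<bar>\<tau> l T\<bar> \<le> 1" if "T \<subseteq> {..<l}" "T \<noteq> {..<l}" for T
    using abs_\<tau>_le_power[OF that r(1,2)] power_le_one[OF r(2,3), of "card T"] by simp
  have le_\<eta>: "\<bar>\<tau> l T\<bar> \<le> \<eta>" if "T \<subseteq> {..<l}" "T \<noteq> {..<l}" "0 < card T" for T
  proof -
    have "\<eta> ^ card T \<le> \<eta> ^ 1" using that r by (intro power_decreasing) auto
    then show ?thesis using abs_\<tau>_le_power[OF that(1,2) r(1,2)] by simp
  qed
  have pow: "(\<eta>\<^sup>2) ^ m \<le> \<eta>" if "0 < m" for m
    using power_decreasing[of 1 "2 * m" \<eta>] that r by (simp add: power_mult)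
  have big: "path_density m \<le> \<eta> * path_density 2" if "3 \<le> m" for m
  proof -
    have "path_density (m - 2 + 2) \<le> (\<eta>\<^sup>2) ^ (m - 2) * path_density 2" by (rule path_density_le[OF r(1)])
    also have "\<dots> \<le> \<eta> * path_density 2"
      using pow[of "m - 2"] that by (intro mult_right_mono) (auto simp: path_density_nonneg)
    moreover have "m - 2 + 2 = m" using that by simp
    ultimately show ?thesis by simp
  qed
  have one: "path_density 1 \<le> \<eta>" "path_density 1 \<le> 1"
    using path_density_le[OF r(1), of 1 0] pow[of 1] r by (auto simp: path_density_0)
  have bound: "\<bar>c * t\<bar> \<le> \<eta> * path_density 2" if "\<bar>c\<bar> \<le> \<eta> * path_density 2" "\<bar>t\<bar> \<le> 1" for c t
    using mult_mono[OF that] r by (simp add: abs_mult path_density_nonneg)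
  have bound': "\<bar>c * t\<bar> \<le> \<eta> * path_density 2" if "\<bar>c\<bar> \<le> path_density 2" "\<bar>t\<bar> \<le> \<eta>" for c t
    using mult_mono[OF that] r by (simp add: abs_mult path_density_nonneg mult.commute)
  have S_ne: "S \<noteq> {}" using S by auto
  obtain m S' where *: "0 < m" "S' \<subseteq> {..<l}" "S' \<noteq> {..<l}" "card S = 2 * m + card S'"
    "\<tau> l S = (- 1) ^ m * path_density m * \<tau> l S'"
    using \<tau>_even_run[OF S(1) S_ne S(2) False] by blast
  have abs: "\<bar>\<tau> l S\<bar> = \<bar>path_density m * \<tau> l S'\<bar>" using * by (simp add: abs_mult power_abs)
  consider "3 \<le> m" | "m = 2" | "m = 1" using *(1) by linarith
  then show ?thesis
  proof cases
    case 1
    then show ?thesis unfolding abs using big le_1 * by (intro bound) (auto simp: path_density_nonneg)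
  next
    case 2
    then show ?thesis unfolding abs using le_\<eta>[of S'] * S by (intro bound') (auto simp: path_density_nonneg)
  next
    case 3
    have "\<tau> l S' \<noteq> 0" using * False by auto
    moreover have "S' \<noteq> {}" using * S 3 by auto
    ultimately obtain m' T where T: "0 < m'" "T \<subseteq> {..<l}" "T \<noteq> {..<l}" "card S' = 2 * m' + card T"
      "\<tau> l S' = (- 1) ^ m' * path_density m' * \<tau> l T"
      using \<tau>_even_run[of S' l] *(2,3) by blast
    have abs': "\<bar>\<tau> l S\<bar> = \<bar>(path_density 1 * path_density m') * \<tau> l T\<bar>"
      using abs T 3 by (simp add: abs_mult power_abs)
    have nn: "\<bar>path_density 1 * path_density m'\<bar> = path_density 1 * path_density m'"
      by (intro abs_of_nonneg mult_nonneg_nonneg path_density_nonneg)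
    consider "3 \<le> m'" | "m' = 2" | "m' = 1" using T(1) by linarith
    then show ?thesis
    proof cases
      case 1
      have "path_density 1 * path_density m' \<le> 1 * (\<eta> * path_density 2)"
        using one big[OF 1] by (intro mult_mono) (auto simp: path_density_nonneg)
      then show ?thesis unfolding abs' by - (rule bound[OF _ le_1[OF T(2,3)]], simp only: nn mult_1)
    next
      case 2
      have "path_density 1 * path_density m' \<le> \<eta> * path_density 2"
        using one r 2 by (intro mult_mono) (auto simp: path_density_nonneg)
      then show ?thesis unfolding abs' by - (rule bound[OF _ le_1[OF T(2,3)]], simp only: nn mult_1)
    next
      case m': 3
      have "path_density 1 * path_density m' \<le> path_density 2"
        using path_density_1_square_le m' by (simp add: power2_eq_square)
      moreover have "0 < card T" using S * T 3 m' by simp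
      ultimately show ?thesis unfolding abs' by - (rule bound'[OF _ le_\<eta>[OF T(2,3)]], simp_all only: nn)
    qed
  qed
qed

lemma \<tau>_run: "i < l \<Longrightarrow> 2 * m < l \<Longrightarrow> \<tau> l (run l i (2 * m)) = (- 1) ^ m * path_density m"
  using \<tau>_run_Un_even[of i l m "{}"] by (simp add: apart_def \<tau>_empty)

text \<open>Disjointness of the runs of length 3 says that the two paths share no vertex.\<close>

lemma \<tau>_two_runs:
  assumes "i < l" "j < l" "2 < l" "run l i 3 \<inter> run l j 3 = {}"
  shows "\<tau> l (run l i 2 \<union> run l j 2) = (path_density 1)\<^sup>2"
proof -
  have "apart l (run l i 3) (run l j 2)"
    using assms(4) unfolding apart_def run_def by (auto simp: mod_Suc_eq)
      (metis (no_types, lifting) IntI Suc_less_eq add_Suc_right empty_iff imageI lessThan_iff less_SucI numeral_2_eq_2 numeral_3_eq_3)+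
  then show ?thesis
    using \<tau>_run_Un_even[of i l 1 "run l j 2"] \<tau>_run[of j l 1] assms run_subset[of l j 2]
    by (simp add: power2_eq_square numeral_3_eq_3)
qed

lemma \<tau>_card_2:
  assumes "S \<subseteq> {..<l}" "S \<noteq> {..<l}" "card S = 2" "\<tau> l S \<noteq> 0"
  shows "\<exists>i<l. S = run l i 2"
proof -
  have "S \<noteq> {}" using assms by auto
  then obtain i m S' where *: "i < l" "0 < m" "S = run l i (2 * m) \<union> S'" "card S = 2 * m + card S'" "S' \<subseteq> {..<l}"
    using \<tau>_even_run[OF assms(1) _ assms(2,4)] by blast
  have "m = 1" "card S' = 0" using * assms(3) by auto
  moreover have "finite S'" using * finite_subset by blast
  ultimately show ?thesis using * by auto
qed

text \<open>The first peeled run has four edges or two; in the latter case the other two edges again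
  form a run.\<close>

lemma \<tau>_card_4:
  assumes "S \<subseteq> {..<l}" "S \<noteq> {..<l}" "card S = 4" "\<tau> l S \<noteq> 0"
  shows "(\<exists>i<l. S = run l i 4) \<or>
    (\<exists>i<l. \<exists>j<l. S = run l i 2 \<union> run l j 2 \<and> run l i 3 \<inter> run l j 3 = {})"
proof -
  have "S \<noteq> {}" using assms by auto
  then obtain i m S' where *: "i < l" "0 < m" "S = run l i (2 * m) \<union> S'" "card S = 2 * m + card S'" 
      "S' \<subseteq> {..<l}" "S' \<noteq> {..<l}" "apart l (run l i (Suc (2 * m))) S'"
      "\<tau> l S = (- 1) ^ m * path_density m * \<tau> l S'"
    using \<tau>_even_run[OF assms(1) _ assms(2,4)] by blast
  have fin: "finite S'" using * finite_subset by blast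
  have "m = 2 \<and> card S' = 0 \<or> m = 1 \<and> card S' = 2" using *(2,4) assms(3) by presburger
  then show ?thesis
  proof (elim disjE conjE, goal_cases)
    case 1
    then show ?thesis using * fin by auto
  next
    case 2
    have "\<tau> l S' \<noteq> 0" using * assms(4) by auto
    then obtain j where j: "j < l" "S' = run l j 2" using \<tau>_card_2[of S' l] * 2 by auto
    \<comment> \<open>Every vertex of the second path is an end of one of its edges, so a common
      vertex contradicts \<open>apart\<close>.\<close>
    have "run l i 3 \<inter> run l j 3 = {}"
    proof (rule ccontr)
      assume "\<not> ?thesis"
      then obtain x where x: "x \<in> run l i 3" "x \<in> run l j 3" by auto
      then consider "x \<in> run l j 2" | "x = Suc ((j + 1) mod l) mod l"
        using run_Suc[of l j 2] by (auto simp: numeral_3_eq_3 numeral_2_eq_2 mod_Suc_eq)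
      then show False
        using *(7) x(1) 2(1) mem_run[of 1 2 j l] j(2)
        by cases (auto simp: apart_def numeral_3_eq_3)
    qed
    then show ?thesis using * j 2 by auto
  qed
qed

end

section \<open>Signed counts in an oriented cycle\<close>

lemma run_2: "i < l \<Longrightarrow> run l i 2 = {i, Suc i mod l}"
  by (auto simp: run_def numeral_2_eq_2 lessThan_Suc)

lemma run_3: "i < l \<Longrightarrow> run l i 3 = {i, Suc i mod l, Suc (Suc i mod l) mod l}"
  by (auto simp: run_def numeral_3_eq_3 lessThan_Suc mod_Suc_eq)

lemma run_4: "i < l \<Longrightarrow> run l i 4 = {i, Suc i mod l, Suc (Suc i mod l) mod l, Suc (Suc (Suc i mod l) mod l) mod l}"
  by (auto simp: run_def eval_nat_numeral lessThan_Suc mod_Suc_eq)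

lemma run_Un_Suc: "0 < k \<Longrightarrow> run l i k \<union> (\<lambda>x. Suc x mod l) ` run l i k = run l i (Suc k)"
proof -
  assume k: "0 < k"
  have "(\<lambda>x. Suc x mod l) ` run l i k = (\<lambda>j. (i + j) mod l) ` Suc ` {..<k}"
    by (simp add: run_def image_image mod_Suc_eq)
  then have "run l i k \<union> (\<lambda>x. Suc x mod l) ` run l i k = (\<lambda>j. (i + j) mod l) ` ({..<k} \<union> Suc ` {..<k})"
    by (simp add: run_def image_Un)
  also have "{..<k} \<union> Suc ` {..<k} = {..<Suc k}"
    unfolding lessThan_Suc_eq_insert_0 using k by (auto simp: image_iff) (metis lessThan_iff not0_implies_Suc Suc_lessD)
  finally show ?thesis by (simp add: run_def)
qed

section \<open>Subgraphs of the oriented cycle as sets of edges\<close>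

locale oriented_cycle =
  fixes l :: nat and R :: "nat rel"
  assumes l_ge: "3 \<le> l" and R_subset: "R \<subseteq> parcs (directed_cycle l)"
begin

abbreviation "nxt x \<equiv> Suc x mod l"

abbreviation "C \<equiv> reverse_arcs R (directed_cycle l)"

definition arc :: "nat \<Rightarrow> nat \<times> nat" where
  "arc i = (if (i, nxt i) \<in> R then (nxt i, i) else (i, nxt i))"

definition orient :: "nat \<Rightarrow> int" where
  "orient i = (if (i, nxt i) \<in> R then - 1 else 1)"

definition edge_subgraph :: "nat set \<Rightarrow> nat pair_pre_digraph" where
  "edge_subgraph S = \<lparr> pverts = S \<union> nxt ` S, parcs = arc ` S \<rparr>"

lemma nxt_less: "nxt x < l"
  using l_ge by (intro mod_less_divisor) simp

text \<open>Length at least 3 rules out loops and antiparallel arcs; an edge is thus traversed in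
  only one of the two directions.\<close>

lemma nxt_neq: "nxt x \<noteq> x" "nxt (nxt x) \<noteq> x"
proof -
  have "nxt x \<noteq> x \<and> nxt (nxt x) \<noteq> x"
  proof (cases "x < l")
    case True
    then have "nxt x = (if Suc x = l then 0 else Suc x)" by (simp add: mod_Suc)
    then show ?thesis using True l_ge by (auto simp: mod_Suc)
  next
    case False
    then show ?thesis using nxt_less by (metis order_less_irrefl)
  qed
  then show "nxt x \<noteq> x" "nxt (nxt x) \<noteq> x" by auto
qed

lemma nxt_inj: "x < l \<Longrightarrow> y < l \<Longrightarrow> nxt x = nxt y \<longleftrightarrow> x = y"
  using Suc_mod_cancel[of x l y] by auto

lemma pverts_C: "pverts C = {..<l}"
  by (simp add: reverse_arcs_def directed_cycle_def)

lemma R_conv: "R = {(i, nxt i) |i. i < l \<and> (i, nxt i) \<in> R}"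
  using R_subset by (auto simp: directed_cycle_def)

lemma parcs_C: "parcs C = arc ` {..<l}"
proof -
  have "parcs C = ({(i, nxt i) |i. i < l} - R) \<union> R\<inverse>"
    by (simp add: reverse_arcs_def directed_cycle_def)
  also have "\<dots> = arc ` {..<l}"
    by (subst (2) R_conv) (auto simp: arc_def image_iff split: if_splits)
  finally show ?thesis .
qed

lemma arc_eq_iff: "x < l \<Longrightarrow> y < l \<Longrightarrow> arc x = arc y \<longleftrightarrow> x = y"
  using nxt_neq(2)[of x] nxt_neq(2)[of y] nxt_inj[of x y] by (auto simp: arc_def split: if_splits)

lemma inj_on_arc: "inj_on arc {..<l}"
  by (auto simp: inj_on_def arc_eq_iff)

lemma fst_snd_arc: "{fst (arc i), snd (arc i)} = {i, nxt i}"
  by (auto simp: arc_def)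

lemma edge_subgraph_wf:
  assumes "S \<subseteq> {..<l}"
  shows "subgraph (with_proj (edge_subgraph S)) (with_proj C)" "no_isolated_verts (edge_subgraph S)"
proof -
  have "pair_wf_digraph (edge_subgraph T)" for T
    by unfold_locales (auto simp: edge_subgraph_def arc_def)
  moreover have "pair_wf_digraph C"
    by unfold_locales (auto simp: parcs_C pverts_C arc_def nxt_less)
  ultimately show "subgraph (with_proj (edge_subgraph S)) (with_proj C)"
    using assms nxt_less
    by (auto simp: subgraph_def compatible_def wf_digraph_wp_iff parcs_C pverts_C edge_subgraph_def)
  show "no_isolated_verts (edge_subgraph S)"
    unfolding no_isolated_verts_def
  proof
    fix v assume "v \<in> pverts (edge_subgraph S)"
    then obtain i where i: "i \<in> S" "v \<in> {i, nxt i}" by (auto simp: edge_subgraph_def)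
    then have "v = fst (arc i) \<or> v = snd (arc i)" using fst_snd_arc[of i] by blast
    then show "\<exists>e \<in> parcs (edge_subgraph S). v = fst e \<or> v = snd e"
      using i by (auto simp: edge_subgraph_def)
  qed
qed

text \<open>Without isolated vertices, the arcs determine the vertices. Signed counts thereby become
  sums over sets of edges.\<close>

lemma subgraph_is_edge_subgraph:
  assumes "subgraph (with_proj H) (with_proj C)" "no_isolated_verts H"
  shows "\<exists>S \<subseteq> {..<l}. H = edge_subgraph S"
proof -
  have sub: "parcs H \<subseteq> arc ` {..<l}" and wf: "pair_wf_digraph H"
    using assms(1) by (auto simp: subgraph_def parcs_C wf_digraph_wp_iff)
  interpret H: pair_wf_digraph H by (rule wf)
  obtain S where S: "S \<subseteq> {..<l}" "parcs H = arc ` S" using sub by (meson subset_imageE)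
  have "x \<in> pverts H \<longleftrightarrow> x \<in> S \<union> nxt ` S" for x
  proof
    assume "x \<in> pverts H"
    then obtain i where "i \<in> S" "x = fst (arc i) \<or> x = snd (arc i)"
      using assms(2) S by (auto simp: no_isolated_verts_def)
    then show "x \<in> S \<union> nxt ` S" using fst_snd_arc[of i] by (auto simp: arc_def split: if_splits)
  next
    assume "x \<in> S \<union> nxt ` S"
    then obtain i where i: "i \<in> S" "x \<in> {i, nxt i}" by auto
    then have "x = fst (arc i) \<or> x = snd (arc i)" using fst_snd_arc[of i] by blast
    moreover have "arc i \<in> parcs H" using i S by simp
    ultimately show "x \<in> pverts H" using H.arc_fst_in_verts H.arc_snd_in_verts by blast
  qed
  then have "pverts H = S \<union> nxt ` S" by blast
  then have "H = edge_subgraph S"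
    using S by (simp add: edge_subgraph_def)
  then show ?thesis using S by blast
qed

lemma edge_subgraph_inj: "inj_on edge_subgraph (Pow {..<l})"
proof (rule inj_onI)
  fix S T assume *: "S \<in> Pow {..<l}" "T \<in> Pow {..<l}" "edge_subgraph S = edge_subgraph T"
  then have "arc ` S = arc ` T" by (metis edge_subgraph_def pair_pre_digraph.select_convs(2))
  then show "S = T" using * inj_on_arc by (simp add: inj_on_image_eq_iff)
qed

definition copies :: "nat pair_pre_digraph \<Rightarrow> nat set set" where
  "copies G = {S. S \<subseteq> {..<l} \<and> (\<exists>f. underlying_iso f G (edge_subgraph S))}"

lemma signed_count_eq_sum:
  "signed_count G C
    = (\<Sum>S \<in> copies G. (- 1) ^ reversed_count (SOME f. underlying_iso f G (edge_subgraph S)) G (edge_subgraph S))"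
proof -
  have "{H. subgraph (with_proj H) (with_proj C) \<and> no_isolated_verts H \<and> (\<exists>f. underlying_iso f G H)}
      = edge_subgraph ` copies G" (is "?L = _")
  proof
    show "?L \<subseteq> edge_subgraph ` copies G"
    proof
      fix H assume H: "H \<in> ?L"
      then obtain S where "S \<subseteq> {..<l}" "H = edge_subgraph S"
        using subgraph_is_edge_subgraph[of H] by auto
      then show "H \<in> edge_subgraph ` copies G" using H by (auto simp: copies_def)
    qed
    show "edge_subgraph ` copies G \<subseteq> ?L"
      using edge_subgraph_wf by (auto simp: copies_def)
  qed
  moreover have "inj_on edge_subgraph (copies G)"
    by (rule inj_on_subset[OF edge_subgraph_inj]) (auto simp: copies_def)
  ultimately show ?thesis unfolding signed_count_def by (simp add: sum.reindex)
qed

lemma adjacent_edge_subgraph: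
  "(x, y) \<in> parcs (mk_symmetric (with_proj (edge_subgraph S)))
    \<longleftrightarrow> (x \<in> S \<and> y = nxt x) \<or> (y \<in> S \<and> x = nxt y)"
  by (auto simp: parcs_mk_symmetric edge_subgraph_def arc_def split: if_splits)

end

text \<open>The graphs \<open>P_3\<close>, \<open>P_5\<close> and \<open>2P_3\<close> are arc-disjoint unions of directed paths
  \<open>c - 1 \<rightarrow> c \<rightarrow> c + 1\<close>. An embedding into a cycle traverses both arcs of such a path in the
  same direction, so traversing it backwards does not change the sign.\<close>

locale cherry_digraph =
  fixes G :: "nat pair_pre_digraph" and M :: "nat set" and m :: nat
  assumes verts: "pverts G = {..<m}"
    and arcs: "parcs G = (\<lambda>c. (c - 1, c)) ` M \<union> (\<lambda>c. (c, Suc c)) ` M"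
    and centres: "c \<in> M \<Longrightarrow> 0 < c \<and> Suc c < m \<and> Suc c \<notin> M"

locale cherry_copy = oriented_cycle l R + cherry_digraph G M m
  for l R G M m +
  fixes f :: "nat \<Rightarrow> nat" and S :: "nat set"
  assumes S: "S \<subseteq> {..<l}" and iso: "underlying_iso f G (edge_subgraph S)"
begin

lemma finite_M: "finite M"
  by (rule finite_subset[of _ "{..<m}"]) (auto dest!: centres)

lemma finite_arcs: "finite (parcs G)"
  by (simp add: arcs finite_M)

lemma arc_cases: "(u, v) \<in> parcs G \<Longrightarrow> v = Suc u \<and> v < m"
  by (auto simp: arcs dest!: centres)

lemma f_inj: "u < m \<Longrightarrow> v < m \<Longrightarrow> f u = f v \<longleftrightarrow> u = v"
  using iso by (auto simp: underlying_iso_def bij_betw_def inj_on_def verts)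

lemma f_image: "f ` {..<m} = S \<union> nxt ` S"
  using iso by (auto simp: underlying_iso_def bij_betw_def verts edge_subgraph_def)

lemma f_less: "u < m \<Longrightarrow> f u < l"
  using f_image S nxt_less by (metis (no_types, lifting) Un_iff image_eqI image_iff lessThan_iff subsetD)

lemma f_adjacent:
  assumes "u < m" "v < m"
  shows "(u, v) \<in> parcs G \<or> (v, u) \<in> parcs G
    \<longleftrightarrow> (f u \<in> S \<and> f v = nxt (f u)) \<or> (f v \<in> S \<and> f u = nxt (f v))"
proof -
  have "(u, v) \<in> parcs (mk_symmetric (with_proj G)) \<longleftrightarrow> (u, v) \<in> parcs G \<or> (v, u) \<in> parcs G"
    by (auto simp: parcs_mk_symmetric Bex_def)
  then show ?thesis
    using iso assms unfolding underlying_iso_def verts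
    by (simp add: adjacent_edge_subgraph)
qed

text \<open>Whether the embedding traverses the arc clockwise. The next definition gives the index
  of the cycle edge onto which the arc falls.\<close>

definition fwd :: "nat \<times> nat \<Rightarrow> bool" where
  "fwd e \<longleftrightarrow> f (snd e) = nxt (f (fst e))"

definition tail_of :: "nat \<times> nat \<Rightarrow> nat" where
  "tail_of e = (if fwd e then f (fst e) else f (snd e))"

lemma fwd_cases:
  assumes "(u, v) \<in> parcs G"
  shows "fwd (u, v) \<and> f u \<in> S \<and> f v = nxt (f u) \<or> \<not> fwd (u, v) \<and> f v \<in> S \<and> f u = nxt (f v)"
proof -
  have "u < m" "v < m" using arc_cases[OF assms] by auto
  then consider "f u \<in> S" "f v = nxt (f u)" | "f v \<in> S" "f u = nxt (f v)"
    using f_adjacent[of u v] assms by blast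
  then show ?thesis
  proof cases
    case 2
    then have "\<not> fwd (u, v)" using nxt_neq(2)[of "f v"] by (simp add: fwd_def)
    then show ?thesis using 2 by blast
  qed (simp add: fwd_def)
qed

text \<open>Turning round at \<open>v\<close> would send \<open>u\<close> and \<open>w\<close> to
  the same vertex.\<close>

lemma fwd_path:
  assumes "(u, v) \<in> parcs G" "(v, w) \<in> parcs G"
  shows "fwd (u, v) \<longleftrightarrow> fwd (v, w)"
proof -
  have "v = Suc u" "v < m" "w = Suc v" "w < m" using assms arc_cases by blast+
  then have "u < m" "w < m" "u \<noteq> w" by auto
  then have *: "f u \<noteq> f w" "f u < l" "f w < l" by (auto simp: f_inj f_less)
  show ?thesis
  proof (rule ccontr)
    assume "\<not> ?thesis"
    then consider "f v = nxt (f u)" "f v = nxt (f w)" | "f u = nxt (f v)" "f w = nxt (f v)"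
      using fwd_cases[OF assms(1)] fwd_cases[OF assms(2)] by blast
    then show False using * nxt_inj[of "f u" "f w"] by cases auto
  qed
qed

text \<open>The index of the image edge gives its two ends and so, by injectivity of
  \<open>f\<close>, the arc. Every edge of \<open>S\<close> is hit since \<open>f\<close> reflects
  adjacency.\<close>

lemma tail_of_bij: "bij_betw tail_of (parcs G) S"
  unfolding bij_betw_def
proof
  show "inj_on tail_of (parcs G)"
  proof (rule inj_onI)
    fix e e' assume *: "e \<in> parcs G" "e' \<in> parcs G" "tail_of e = tail_of e'"
    obtain u u' where e: "e = (u, Suc u)" "Suc u < m" "e' = (u', Suc u')" "Suc u' < m"
      using arc_cases *(1,2) by (metis surj_pair)
    have "{f u, f (Suc u)} = {tail_of e, nxt (tail_of e)}" if "(u, Suc u) \<in> parcs G" "e = (u, Suc u)" for u e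
      using fwd_cases[OF that(1)] that(2) by (auto simp: tail_of_def)
    then have "{f u, f (Suc u)} = {f u', f (Suc u')}" using e * by metis
    then have "u = u' \<or> u = Suc u' \<and> Suc u = u'"
      using e by (auto simp: doubleton_eq_iff f_inj)
    then show "e = e'" using e by auto
  qed
  show "tail_of ` parcs G = S"
  proof
    show "tail_of ` parcs G \<subseteq> S"
    proof
      fix i assume "i \<in> tail_of ` parcs G"
      then obtain u v where "(u, v) \<in> parcs G" "i = tail_of (u, v)" by auto
      then show "i \<in> S" using fwd_cases[of u v] by (auto simp: tail_of_def)
    qed
    show "S \<subseteq> tail_of ` parcs G"
    proof
      fix i assume i: "i \<in> S"
      then obtain u v where uv: "u < m" "f u = i" "v < m" "f v = nxt i"
        using f_image by (metis (no_types, lifting) UnI1 UnI2 imageE imageI lessThan_iff)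
      then have "(u, v) \<in> parcs G \<or> (v, u) \<in> parcs G" using f_adjacent i by blast
      then show "i \<in> tail_of ` parcs G"
      proof
        assume "(u, v) \<in> parcs G"
        moreover have "tail_of (u, v) = i" using uv by (simp add: tail_of_def fwd_def)
        ultimately show ?thesis by force
      next
        assume "(v, u) \<in> parcs G"
        moreover have "tail_of (v, u) = i" using uv nxt_neq(2)[of i] by (auto simp: tail_of_def fwd_def)
        ultimately show ?thesis by force
      qed
    qed
  qed
qed

text \<open>Whether an arc is reversed depends on two signs: the orientation of the cycle edge and
  the direction of traversal.\<close>

lemma reversed_sign:
  assumes "(u, v) \<in> parcs G"
  shows "(if (f v, f u) \<in> parcs (edge_subgraph S) then - 1 else 1)
    = orient (tail_of (u, v)) * (if fwd (u, v) then 1 else - 1)"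
proof -
  have mem: "(nxt i, i) \<in> arc ` S \<longleftrightarrow> (i, nxt i) \<in> R" "(i, nxt i) \<in> arc ` S \<longleftrightarrow> (i, nxt i) \<notin> R"
    if "i \<in> S" for i
    using that nxt_neq(2) by (auto simp: arc_def image_iff split: if_splits) metis+
  consider "fwd (u, v)" "f u \<in> S" "f v = nxt (f u)" | "\<not> fwd (u, v)" "f v \<in> S" "f u = nxt (f v)"
    using fwd_cases[OF assms] by blast
  then show ?thesis
    by cases (simp_all add: tail_of_def edge_subgraph_def mem orient_def)
qed

text \<open>The traversal signs cancel within each pair of arcs around a centre, leaving a product
  over \<open>S\<close> that does not depend on \<open>f\<close>. The choice made by
  \<open>SOME\<close> is therefore harmless.\<close>

lemma sign_reversed_count:
  "(- 1) ^ reversed_count f G (edge_subgraph S) = (\<Prod>i \<in> S. orient i)"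
proof -
  let ?P = "\<lambda>(u, v). (f v, f u) \<in> parcs (edge_subgraph S)"
  have fwd_prod: "(\<Prod>e \<in> parcs G. if fwd e then 1 else - 1 :: int) = 1"
  proof -
    have disj: "(\<lambda>c. (c - 1, c)) ` M \<inter> (\<lambda>c. (c, Suc c)) ` M = {}"
      using centres by auto (metis Suc_pred)
    have "(\<Prod>e \<in> parcs G. if fwd e then 1 else - 1 :: int)
        = (\<Prod>c \<in> M. if fwd (c - 1, c) then 1 else - 1) * (\<Prod>c \<in> M. if fwd (c, Suc c) then 1 else - 1)"
      unfolding arcs by (subst prod.union_disjoint[OF _ _ disj]) (simp_all add: finite_M prod.reindex inj_on_def)
    also have "\<dots> = (\<Prod>c \<in> M. (if fwd (c - 1, c) then 1 else - 1) * (if fwd (c, Suc c) then 1 else - 1))"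
      by (simp add: prod.distrib)
    also have "\<dots> = (\<Prod>c \<in> M. 1)"
    proof (intro prod.cong refl)
      fix c assume "c \<in> M"
      then have "fwd (c - 1, c) \<longleftrightarrow> fwd (c, Suc c)" by (intro fwd_path) (auto simp: arcs)
      then show "(if fwd (c - 1, c) then 1 else - 1) * (if fwd (c, Suc c) then 1 else - 1) = (1 :: int)" by simp
    qed
    finally show ?thesis by simp
  qed
  have "reversed_count f G (edge_subgraph S) = card {e \<in> parcs G. ?P e}"
    unfolding reversed_count_def by (rule arg_cong[where f = card]) auto
  then have "(- 1) ^ reversed_count f G (edge_subgraph S) = (\<Prod>e \<in> parcs G. if ?P e then - 1 else 1 :: int)"
    using finite_arcs by (simp add: prod.If_cases Int_def)
  also have "\<dots> = (\<Prod>e \<in> parcs G. orient (tail_of e) * (if fwd e then 1 else - 1))"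
  proof (intro prod.cong refl)
    fix e assume "e \<in> parcs G"
    then show "(if ?P e then - 1 else 1) = orient (tail_of e) * (if fwd e then 1 else - 1)"
      using reversed_sign[of "fst e" "snd e"] by (simp add: case_prod_beta)
  qed
  also have "\<dots> = (\<Prod>e \<in> parcs G. orient (tail_of e))"
    by (simp add: prod.distrib fwd_prod)
  also have "\<dots> = (\<Prod>i \<in> S. orient i)"
    by (rule prod.reindex_bij_betw[OF tail_of_bij])
  finally show ?thesis .
qed

end

lemma (in oriented_cycle) signed_count_cherry:
  assumes "cherry_digraph G M m"
  shows "signed_count G C = (\<Sum>S \<in> copies G. \<Prod>i \<in> S. orient i)"
  unfolding signed_count_eq_sum
proof (intro sum.cong refl)
  fix S assume S: "S \<in> copies G"
  interpret cherry_digraph G M m by (rule assms)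
  let ?f = "SOME f. underlying_iso f G (edge_subgraph S)"
  have "\<exists>f. underlying_iso f G (edge_subgraph S)" using S by (simp add: copies_def)
  then have "underlying_iso ?f G (edge_subgraph S)" by (rule someI_ex)
  then interpret cherry_copy l R G M m ?f S
    using S by unfold_locales (simp_all add: copies_def)
  show "(- 1) ^ reversed_count ?f G (edge_subgraph S) = (\<Prod>i \<in> S. orient i)"
    by (rule sign_reversed_count)
qed

section \<open>The copies of \<open>P_3\<close>, \<open>P_5\<close> and \<open>2P_3\<close> in the
  cycle\<close>

lemma arcs_P3: "parcs (directed_path 3) = {(0, 1), (1, 2)}"
  by (auto simp: directed_path_def)

lemma arcs_P5: "parcs (directed_path 5) = {(0, 1), (1, 2), (2, 3), (3, 4)}"
  by (auto simp: directed_path_def)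

lemma cherry_P3: "cherry_digraph (directed_path 3) {1} 3"
  by unfold_locales (simp_all add: arcs_P3, auto simp: directed_path_def)

lemma cherry_P5: "cherry_digraph (directed_path 5) {1, 3} 5"
  by unfold_locales (auto simp: arcs_P5, auto simp: directed_path_def)

lemma cherry_2P3: "cherry_digraph two_directed_P3 {1, 4} 6"
  by unfold_locales (auto simp: two_directed_P3_def)

context cherry_copy
begin

lemma copy_card: "card (S \<union> nxt ` S) = m"
proof -
  have "bij_betw f {..<m} (S \<union> nxt ` S)"
    using iso by (simp add: underlying_iso_def verts edge_subgraph_def)
  then show ?thesis by (metis bij_betw_same_card card_lessThan)
qed

lemma S_eq: "S = tail_of ` parcs G"
  using tail_of_bij by (simp add: bij_betw_def)

text \<open>Both arcs go the same way round, so the image is a run starting at \<open>f u\<close>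
  (clockwise) or at \<open>f w\<close> (anticlockwise).\<close>

lemma cherry_run:
  assumes "(u, v) \<in> parcs G" "(v, w) \<in> parcs G"
  shows "\<exists>i<l. {tail_of (u, v), tail_of (v, w)} = run l i 2 \<and> {f u, f v, f w} = run l i 3"
proof (cases "fwd (u, v)")
  case True
  then have "fwd (v, w)" using fwd_path[OF assms] by simp
  then have "f v = nxt (f u)" "f w = nxt (f v)" using True by (auto simp: fwd_def)
  moreover have "f u < l" using f_less arc_cases[OF assms(1)] by simp
  ultimately show ?thesis
    using True \<open>fwd (v, w)\<close> by (intro exI[of _ "f u"]) (auto simp: tail_of_def run_2 run_3)
next
  case False
  then have nf: "\<not> fwd (v, w)" using fwd_path[OF assms] by simp
  have "f u = nxt (f v)" "f v = nxt (f w)" using fwd_cases[OF assms(1)] fwd_cases[OF assms(2)] False nf by auto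
  moreover have "f w < l" using f_less arc_cases[OF assms(2)] by simp
  ultimately show ?thesis
    using False nf by (intro exI[of _ "f w"]) (auto simp: tail_of_def run_2 run_3)
qed

end

context oriented_cycle
begin

lemma copies_cherry_copy:
  assumes "cherry_digraph G M m" "S \<in> copies G"
  obtains f where "cherry_copy l R G M m f S"
proof -
  interpret cherry_digraph G M m by (rule assms(1))
  obtain f where "underlying_iso f G (edge_subgraph S)" "S \<subseteq> {..<l}" using assms(2) by (auto simp: copies_def)
  then have "cherry_copy l R G M m f S" by unfold_locales
  then show thesis by (rule that)
qed

text \<open>The rotation \<open>j \<mapsto> (i + j) mod l\<close> is an isomorphism onto the run;
  \<open>k < l\<close> keeps it injective on the \<open>k + 1\<close> vertices.\<close>

lemma run_in_copies:
  assumes "i < l" "0 < k" "k < l"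
  shows "run l i k \<in> copies (directed_path (Suc k))"
proof -
  let ?f = "\<lambda>j. (i + j) mod l"
  have inj: "?f u = ?f v \<longleftrightarrow> u = v" if "u < l" "v < l" for u v
    using inj_on_eq_iff[OF inj_on_rotate[of i l], of u v] that by blast
  have "bij_betw ?f {..<Suc k} (run l i (Suc k))"
    using inj assms by (auto simp: bij_betw_def inj_on_def run_def)
  then have bij: "bij_betw ?f (pverts (directed_path (Suc k))) (pverts (edge_subgraph (run l i k)))"
    using run_Un_Suc[OF assms(2), of l i] by (simp add: directed_path_def edge_subgraph_def)
  have step: "?f u \<in> run l i k \<and> ?f v = nxt (?f u) \<longleftrightarrow> v = Suc u" if "u < Suc k" "v < Suc k" for u v
  proof -
    have "?f u \<in> run l i k \<longleftrightarrow> u < k"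
    proof
      assume "?f u \<in> run l i k"
      then obtain j where "j < k" "?f u = ?f j" by (auto simp: run_def)
      then show "u < k" using inj[of u j] that assms by simp
    qed (rule mem_run)
    moreover have "nxt (?f u) = ?f (Suc u)" by (simp add: mod_Suc_eq)
    moreover have "u < k \<Longrightarrow> ?f v = ?f (Suc u) \<longleftrightarrow> v = Suc u" using inj[of v "Suc u"] that assms by simp
    ultimately show ?thesis using that by auto
  qed
  have "(u, v) \<in> parcs (mk_symmetric (with_proj (directed_path (Suc k)))) \<longleftrightarrow>
      (?f u, ?f v) \<in> parcs (mk_symmetric (with_proj (edge_subgraph (run l i k))))"
    if "u < Suc k" "v < Suc k" for u v
  proof -
    have "(u, v) \<in> parcs (mk_symmetric (with_proj (directed_path (Suc k)))) \<longleftrightarrow> v = Suc u \<or> u = Suc v"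
      using that by (auto simp: parcs_mk_symmetric directed_path_def)
    then show ?thesis unfolding adjacent_edge_subgraph step[OF that] step[OF that(2,1)] .
  qed
  then have "underlying_iso ?f (directed_path (Suc k)) (edge_subgraph (run l i k))"
    using bij by (simp add: underlying_iso_def directed_path_def)
  then show ?thesis using run_subset[of l i k] assms by (auto simp: copies_def)
qed

lemma copies_P3: "copies (directed_path 3) = (\<lambda>i. run l i 2) ` {..<l}"
proof
  show "(\<lambda>i. run l i 2) ` {..<l} \<subseteq> copies (directed_path 3)"
    using run_in_copies[of _ 2] l_ge by auto
  show "copies (directed_path 3) \<subseteq> (\<lambda>i. run l i 2) ` {..<l}"
  proof
    fix S assume "S \<in> copies (directed_path 3)"
    then obtain f where "cherry_copy l R (directed_path 3) {1} 3 f S"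
      by (rule copies_cherry_copy[OF cherry_P3])
    then interpret cherry_copy l R "directed_path 3" "{1}" 3 f S .
    show "S \<in> (\<lambda>i. run l i 2) ` {..<l}"
      using cherry_run[of 0 1 2] S_eq by (auto simp: arcs_P3)
  qed
qed

text \<open>All four arcs are traversed in the same direction, so the image is the run of length 4
  that starts at \<open>f 0\<close> or at \<open>f 4\<close>.\<close>

lemma copies_P5:
  assumes "5 \<le> l"
  shows "copies (directed_path 5) = (\<lambda>i. run l i 4) ` {..<l}"
proof
  show "(\<lambda>i. run l i 4) ` {..<l} \<subseteq> copies (directed_path 5)"
    using run_in_copies[of _ 4] assms by auto
  show "copies (directed_path 5) \<subseteq> (\<lambda>i. run l i 4) ` {..<l}"
  proof
    fix S assume "S \<in> copies (directed_path 5)"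
    then obtain f where "cherry_copy l R (directed_path 5) {1, 3} 5 f S"
      by (rule copies_cherry_copy[OF cherry_P5])
    then interpret cherry_copy l R "directed_path 5" "{1, 3}" 5 f S .
    have arcs: "(0, 1) \<in> parcs (directed_path 5)" "(1, 2) \<in> parcs (directed_path 5)"
      "(2, 3) \<in> parcs (directed_path 5)" "(3, 4) \<in> parcs (directed_path 5)"
      by (auto simp: arcs_P5)
    have S': "S = {tail_of (0, 1), tail_of (1, 2), tail_of (2, 3), tail_of (3, 4)}"
      unfolding S_eq by (simp add: arcs_P5)
    have same: "fwd (0, 1) = fwd (1, 2)" "fwd (1, 2) = fwd (2, 3)" "fwd (2, 3) = fwd (3, 4)"
      by (rule fwd_path[OF arcs(1,2)], rule fwd_path[OF arcs(2,3)], rule fwd_path[OF arcs(3,4)])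
    show "S \<in> (\<lambda>i. run l i 4) ` {..<l}"
    proof (cases "fwd (0, 1)")
      case True
      then have fw: "fwd (0, 1)" "fwd (1, 2)" "fwd (2, 3)" "fwd (3, 4)" using same by auto
      then have eqs: "f 1 = nxt (f 0)" "f 2 = nxt (f 1)" "f 3 = nxt (f 2)" by (auto simp: fwd_def)
      have "S = {f 0, f 1, f 2, f 3}" using S' fw by (simp add: tail_of_def)
      also have "\<dots> = run l (f 0) 4" using f_less[of 0] by (simp only: run_4 eqs)
      finally show ?thesis using f_less[of 0] by auto
    next
      case False
      then have nfw: "\<not> fwd (0, 1)" "\<not> fwd (1, 2)" "\<not> fwd (2, 3)" "\<not> fwd (3, 4)" using same by auto
      then have eqs: "f 1 = nxt (f 2)" "f 2 = nxt (f 3)" "f 3 = nxt (f 4)"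
        using fwd_cases[OF arcs(2)] fwd_cases[OF arcs(3)] fwd_cases[OF arcs(4)] by blast+
      have "S = {f 4, f 3, f 2, f 1}" using S' nfw by (auto simp: tail_of_def)
      also have "\<dots> = run l (f 4) 4" using f_less[of 4] by (simp only: run_4 eqs)
      finally show ?thesis using f_less[of 4] by auto
    qed
  qed
qed

text \<open>A check of all 36 pairs of vertices. The successor \<open>s\<close> is abstract so that
  only the distinctness of the six vertices and the four steps enter.\<close>

lemma two_P3_adjacency:
  fixes s :: "nat \<Rightarrow> nat"
  assumes "distinct [x0, x1, x2, y0, y1, y2]"
    and "s x0 = x1" "s x1 = x2" "s y0 = y1" "s y1 = y2"
    and "u < 6" "v < 6"
  shows "(u, v) \<in> parcs two_directed_P3 \<or> (v, u) \<in> parcs two_directed_P3 \<longleftrightarrow>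
    (let f = (!) [x0, x1, x2, y0, y1, y2]; S = {x0, x1, y0, y1} in
      f u \<in> S \<and> f v = s (f u) \<or> f v \<in> S \<and> f u = s (f v))"
proof -
  have neq: "x0 \<noteq> x1" "x0 \<noteq> x2" "x0 \<noteq> y0" "x0 \<noteq> y1" "x0 \<noteq> y2" "x1 \<noteq> x2" "x1 \<noteq> y0" "x1 \<noteq> y1"
     "x1 \<noteq> y2" "x2 \<noteq> y0" "x2 \<noteq> y1" "x2 \<noteq> y2" "y0 \<noteq> y1" "y0 \<noteq> y2" "y1 \<noteq> y2"
    using assms(1) by auto
  have u: "u = 0 \<or> u = 1 \<or> u = 2 \<or> u = 3 \<or> u = 4 \<or> u = 5"
   and v: "v = 0 \<or> v = 1 \<or> v = 2 \<or> v = 3 \<or> v = 4 \<or> v = 5" using assms(6,7) by auto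
  show ?thesis using u
    by (elim disjE; use v in \<open>elim disjE; simp add: two_directed_P3_def assms(2-5) neq neq[symmetric]\<close>)
qed

lemma two_runs_in_copies:
  assumes "i < l" "j < l" and disj: "run l i 3 \<inter> run l j 3 = {}"
  shows "run l i 2 \<union> run l j 2 \<in> copies two_directed_P3"
proof -
  let ?f = "(!) [i, nxt i, nxt (nxt i), j, nxt j, nxt (nxt j)]"
  let ?S = "run l i 2 \<union> run l j 2"
  have dist: "distinct [i, nxt i, nxt (nxt i), j, nxt j, nxt (nxt j)]"
    using disj nxt_neq[of i] nxt_neq[of j] nxt_neq(1)[of "nxt i"] nxt_neq(1)[of "nxt j"]
    by (auto simp: run_3 assms)
  have S_eq: "?S = {i, nxt i, j, nxt j}" by (auto simp: run_2 assms)
  have "set [i, nxt i, nxt (nxt i), j, nxt j, nxt (nxt j)] = ?S \<union> nxt ` ?S"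
    unfolding S_eq by auto
  then have bij: "bij_betw ?f (pverts two_directed_P3) (pverts (edge_subgraph ?S))"
    using bij_betw_nth[OF dist refl refl] by (simp add: two_directed_P3_def edge_subgraph_def eval_nat_numeral)
  have "(u, v) \<in> parcs (mk_symmetric (with_proj two_directed_P3)) \<longleftrightarrow>
      (?f u, ?f v) \<in> parcs (mk_symmetric (with_proj (edge_subgraph ?S)))" if "u < 6" "v < 6" for u v
  proof -
    have "(u, v) \<in> parcs (mk_symmetric (with_proj two_directed_P3)) \<longleftrightarrow>
        (u, v) \<in> parcs two_directed_P3 \<or> (v, u) \<in> parcs two_directed_P3"
      by (auto simp: parcs_mk_symmetric Bex_def)
    then show ?thesis
      unfolding adjacent_edge_subgraph S_eq
      using two_P3_adjacency[where s = nxt, OF dist refl refl refl refl that] by (simp only: Let_def)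
  qed
  then have "underlying_iso ?f two_directed_P3 (edge_subgraph ?S)"
    using bij by (simp add: underlying_iso_def two_directed_P3_def)
  then show ?thesis using run_subset[of l i 2] run_subset[of l j 2] assms by (auto simp: copies_def)
qed

lemma copies_2P3:
  "copies two_directed_P3 = {run l i 2 \<union> run l j 2 |i j. i < l \<and> j < l \<and> run l i 3 \<inter> run l j 3 = {}}"
    (is "_ = ?X")
proof
  show "?X \<subseteq> copies two_directed_P3" using two_runs_in_copies by auto
  show "copies two_directed_P3 \<subseteq> ?X"
  proof
    fix S assume "S \<in> copies two_directed_P3"
    then obtain f where "cherry_copy l R two_directed_P3 {1, 4} 6 f S"
      by (rule copies_cherry_copy[OF cherry_2P3])
    then interpret cherry_copy l R two_directed_P3 "{1, 4}" 6 f S .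
    have arcs: "parcs two_directed_P3 = {(0, 1), (1, 2), (3, 4), (4, 5)}"
      by (simp add: two_directed_P3_def)
    obtain i where i: "i < l" "{tail_of (0, 1), tail_of (1, 2)} = run l i 2" "{f 0, f 1, f 2} = run l i 3"
      using cherry_run[of 0 1 2] by (auto simp: arcs)
    obtain j where j: "j < l" "{tail_of (3, 4), tail_of (4, 5)} = run l j 2" "{f 3, f 4, f 5} = run l j 3"
      using cherry_run[of 3 4 5] by (auto simp: arcs)
    have "S = run l i 2 \<union> run l j 2"
      using S_eq unfolding arcs i(2)[symmetric] j(2)[symmetric] by auto
    moreover have "run l i 3 \<inter> run l j 3 = {}"
      unfolding i(3)[symmetric] j(3)[symmetric] by (auto simp: f_inj)
    ultimately show "S \<in> ?X" using i(1) j(1) by blast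
  qed
qed

lemma card_copies_P3: "S \<in> copies (directed_path 3) \<Longrightarrow> card S = 2"
  using l_ge by (auto simp: copies_P3 card_run)

lemma card_copies_P5: "5 \<le> l \<Longrightarrow> S \<in> copies (directed_path 5) \<Longrightarrow> card S = 4"
  by (auto simp: copies_P5 card_run)

lemma card_copies_2P3: "S \<in> copies two_directed_P3 \<Longrightarrow> card S = 4"
proof -
  assume "S \<in> copies two_directed_P3"
  then obtain i j where *: "S = run l i 2 \<union> run l j 2" "run l i 3 \<inter> run l j 3 = {}"
    by (auto simp: copies_2P3)
  have "run l i 2 \<inter> run l j 2 = {}" using *(2) by (auto simp: numeral_3_eq_3 run_Suc numeral_2_eq_2)
  then show ?thesis using * l_ge by (simp add: card_Un_disjoint finite_run card_run)
qed

text \<open>Both kinds of copy have four edges, but one has five vertices and the other six.\<close>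

lemma copies_disjoint: "copies (directed_path 5) \<inter> copies two_directed_P3 = {}"
proof (rule ccontr)
  assume "\<not> ?thesis"
  then obtain S where S: "S \<in> copies (directed_path 5)" "S \<in> copies two_directed_P3" by auto
  obtain f where "cherry_copy l R (directed_path 5) {1, 3} 5 f S"
    using copies_cherry_copy[OF cherry_P5 S(1)] .
  moreover obtain g where "cherry_copy l R two_directed_P3 {1, 4} 6 g S"
    using copies_cherry_copy[OF cherry_2P3 S(2)] .
  ultimately have "(5::nat) = 6" using cherry_copy.copy_card by metis
  then show False by simp
qed

lemma length_ge_5:
  assumes "signed_count (directed_path 5) C \<noteq> 0"
  shows "5 \<le> l"
proof -
  obtain S where S: "S \<in> copies (directed_path 5)"
    using assms signed_count_cherry[OF cherry_P5] by (metis equals0I sum.empty)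
  then obtain f where "cherry_copy l R (directed_path 5) {1, 3} 5 f S"
    by (rule copies_cherry_copy[OF cherry_P5])
  then have "card (S \<union> nxt ` S) = 5" by (rule cherry_copy.copy_card)
  moreover have "S \<union> nxt ` S \<subseteq> {..<l}" using S nxt_less by (auto simp: copies_def)
  ultimately show ?thesis using card_mono[of "{..<l}" "S \<union> nxt ` S"] by simp
qed

lemma prod_orient: "(\<Prod>i<l. orient i) = (- 1) ^ card R"
proof -
  have "R = (\<lambda>i. (i, nxt i)) ` {i \<in> {..<l}. (i, nxt i) \<in> R}" by (subst R_conv) auto
  then have "card R = card {i \<in> {..<l}. (i, nxt i) \<in> R}"
    by (metis (no_types, lifting) card_image inj_onI prod.inject)
  then show ?thesis unfolding orient_def by (simp add: prod.If_cases Int_def)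
qed

end

section \<open>The expansion around the constant tournament\<close>

context oriented_cycle
begin

text \<open>The coefficient of the density of \<open>S\<close> in the expansion of
  \<open>2 ^ l * hom_density C n A\<close>.\<close>

definition weight :: "nat set \<Rightarrow> real" where
  "weight S = real_of_int (\<Prod>i \<in> S. orient i) * 2 ^ card S"

lemma abs_weight: "finite S \<Longrightarrow> \<bar>weight S\<bar> = 2 ^ card S"
  by (simp add: weight_def abs_mult orient_def if_distrib flip: of_int_prod) 
    (simp add: abs_prod orient_def if_distrib cong: prod.cong)

text \<open>Skew symmetry turns twice the factor of each arc into \<open>1\<close> plus or minus
  \<open>2 * b\<close> along the clockwise edge; the product is then expanded over subsets of the
  edges.\<close>

lemma hom_density_expansion:
  assumes "0 < n" and A: "\<And>x y. x < n \<Longrightarrow> y < n \<Longrightarrow> A $$ (x, y) = 1 / 2 + b x y"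
    and skew: "\<And>x y. x < n \<Longrightarrow> y < n \<Longrightarrow> b y x = - b x y"
  shows "2 ^ l * hom_density C n A
    = (\<Sum>S \<in> Pow {..<l}. weight S * (hom_sum n b {..<l} (cycle_arcs l S) / real n ^ l))"
proof -
  have pointwise: "2 ^ l * (\<Prod>(x, y) \<in> parcs C. A $$ (\<phi> x, \<phi> y))
      = (\<Sum>S \<in> Pow {..<l}. weight S * (\<Prod>(u, v) \<in> cycle_arcs l S. b (\<phi> u) (\<phi> v)))"
    if \<phi>: "\<phi> \<in> {..<l} \<rightarrow>\<^sub>E {..<n}" for \<phi>
  proof -
    have less: "\<phi> i < n" if "i < l" for i using \<phi> that by (auto simp: PiE_def Pi_def)
    have "2 ^ l * (\<Prod>(x, y) \<in> parcs C. A $$ (\<phi> x, \<phi> y))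
        = (\<Prod>i<l. 2 * (case arc i of (x, y) \<Rightarrow> A $$ (\<phi> x, \<phi> y)))"
      unfolding parcs_C prod.reindex[OF inj_on_arc] prod.distrib by simp
    also have "\<dots> = (\<Prod>i<l. (2 * real_of_int (orient i) * b (\<phi> i) (\<phi> (nxt i))) + 1)"
    proof (intro prod.cong refl)
      fix i assume "i \<in> {..<l}"
      then have "\<phi> i < n" "\<phi> (nxt i) < n" using less nxt_less by auto
      then show "2 * (case arc i of (x, y) \<Rightarrow> A $$ (\<phi> x, \<phi> y))
          = (2 * real_of_int (orient i) * b (\<phi> i) (\<phi> (nxt i))) + 1"
        using skew[of "\<phi> i" "\<phi> (nxt i)"] by (simp add: arc_def orient_def A algebra_simps)
    qed
    also have "\<dots> = (\<Sum>S \<in> Pow {..<l}. \<Prod>i \<in> S. 2 * real_of_int (orient i) * b (\<phi> i) (\<phi> (nxt i)))"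
      by (subst prod_add) simp_all
    also have "\<dots> = (\<Sum>S \<in> Pow {..<l}. weight S * (\<Prod>(u, v) \<in> cycle_arcs l S. b (\<phi> u) (\<phi> v)))"
      by (intro sum.cong refl) (simp add: cycle_arcs_def prod_arcs prod.distrib weight_def)
    finally show ?thesis .
  qed
  have "2 ^ l * hom_density C n A
      = (\<Sum>\<phi> \<in> {..<l} \<rightarrow>\<^sub>E {..<n}. 2 ^ l * (\<Prod>(x, y) \<in> parcs C. A $$ (\<phi> x, \<phi> y))) / real n ^ l"
    by (simp add: hom_density_def pverts_C sum_distrib_left)
  also have "\<dots> = (\<Sum>S \<in> Pow {..<l}. weight S * hom_sum n b {..<l} (cycle_arcs l S)) / real n ^ l"
    unfolding hom_sum_def sum_distrib_left
    by (subst sum.swap) (simp add: pointwise)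
  finally show ?thesis by (simp add: sum_divide_distrib)
qed

definition P5_count :: int where "P5_count = signed_count (directed_path 5) C"
definition P33_count :: int where "P33_count = signed_count two_directed_P3 C"

definition large_sets :: "nat set set" where
  "large_sets = {S. S \<subseteq> {..<l} \<and> S \<noteq> {..<l} \<and> 5 \<le> card S}"

lemma finite_copies: "finite (copies G)"
  by (rule finite_subset[of _ "Pow {..<l}"]) (auto simp: copies_def)

lemma card_parcs_C: "card (parcs C) = l"
  unfolding parcs_C by (simp add: card_image[OF inj_on_arc])

end

text \<open>The vanishing count of \<open>P_3\<close> removes the quadratic term, and
  \<open>5 \<le> l\<close> puts the full edge set beyond order four.\<close>

locale cycle_kernel = oriented_cycle l R + skew_kernel n b for l R n b +
  assumes l_ge_5: "5 \<le> l" and P3_zero: "signed_count (directed_path 3) C = 0"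
begin

text \<open>The coefficient of \<open>\<delta> ^ 4\<close> when the kernel is scaled by
  \<open>\<delta>\<close>; the factor 16 is the \<open>2 ^ 4\<close> in the weights of four
  edges.\<close>

definition quartic :: real where
  "quartic = 16 * (P5_count * path_density 2 + P33_count * (path_density 1)\<^sup>2)"

lemma \<tau>_copies:
  shows "S \<in> copies (directed_path 3) \<Longrightarrow> \<tau> l S = - path_density 1"
    and "S \<in> copies (directed_path 5) \<Longrightarrow> \<tau> l S = path_density 2"
    and "S \<in> copies two_directed_P3 \<Longrightarrow> \<tau> l S = (path_density 1)\<^sup>2"
  using \<tau>_run[of _ l 1] \<tau>_run[of _ l 2] \<tau>_two_runs l_ge_5
  by (auto simp: copies_P3 copies_P5 copies_2P3)

lemma sum_copies:
  assumes "\<And>S. S \<in> copies G \<Longrightarrow> \<tau> l S = c" "\<And>S. S \<in> copies G \<Longrightarrow> card S = k"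
    and "cherry_digraph G M m"
  shows "(\<Sum>S \<in> copies G. weight S * \<tau> l S * \<delta> ^ card S) = 2 ^ k * c * \<delta> ^ k * signed_count G C"
proof -
  have "(\<Sum>S \<in> copies G. weight S * \<tau> l S * \<delta> ^ card S)
      = (\<Sum>S \<in> copies G. 2 ^ k * c * \<delta> ^ k * real_of_int (\<Prod>i \<in> S. orient i))"
    using assms(1,2) by (intro sum.cong) (auto simp: weight_def)
  then show ?thesis by (simp add: signed_count_cherry[OF assms(3)] sum_distrib_left)
qed

text \<open>Among proper subsets with at most four edges, only the empty set and the copies of
  \<open>P_3\<close>, \<open>P_5\<close> and \<open>2P_3\<close> have nonzero density, and the
  copies of \<open>P_3\<close> cancel. The parameter \<open>\<delta>\<close> serves the
  perturbations later; \<open>\<delta> = 1\<close> gives the plain expansion.\<close>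

lemma expansion_proper:
  "(\<Sum>S \<in> Pow {..<l} - {{..<l}}. weight S * \<tau> l S * \<delta> ^ card S)
    = 1 + quartic * \<delta> ^ 4 + (\<Sum>S \<in> large_sets. weight S * \<tau> l S * \<delta> ^ card S)"
proof -
  let ?g = "\<lambda>S. weight S * \<tau> l S * \<delta> ^ card S"
  let ?P3 = "copies (directed_path 3)" and ?P5 = "copies (directed_path 5)" and ?P33 = "copies two_directed_P3"
  let ?T = "{{}} \<union> (?P3 \<union> (?P5 \<union> (?P33 \<union> large_sets)))"
  have fin: "finite large_sets"
    by (rule finite_subset[of _ "Pow {..<l}"]) (auto simp: large_sets_def)
  have proper: "S \<noteq> {..<l}" if "card S \<le> 4" for S using that l_ge_5 by auto
  have copies_proper: "copies G \<subseteq> Pow {..<l} - {{..<l}}" if "\<And>S. S \<in> copies G \<Longrightarrow> card S \<le> 4" for G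
    using that proper by (auto simp: copies_def)
  have "?T \<subseteq> Pow {..<l} - {{..<l}}"
    by (intro Un_least copies_proper)
      (use l_ge_5 proper[of "{}"] in \<open>auto simp: card_copies_P3 card_copies_P5 card_copies_2P3 large_sets_def\<close>)
  moreover have "?g S = 0" if S: "S \<in> Pow {..<l} - {{..<l}} - ?T" for S
  proof (rule ccontr)
    assume "?g S \<noteq> 0"
    then have nz: "\<tau> l S \<noteq> 0" by auto
    have sub: "S \<subseteq> {..<l}" "S \<noteq> {..<l}" using S by auto
    have "card S \<noteq> 0" using S finite_subset[OF sub(1)] by auto
    moreover have "card S < 5" using S sub by (auto simp: large_sets_def)
    moreover have "even (card S)" using \<tau>_odd[OF sub] nz by blast
    moreover have "\<And>k :: nat. k \<noteq> 0 \<Longrightarrow> k < 5 \<Longrightarrow> even k \<Longrightarrow> k = 2 \<or> k = 4" by presburger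
    ultimately have "card S = 2 \<or> card S = 4" by blast
    then show False
    proof
      assume "card S = 2"
      then have "S \<in> ?P3" using \<tau>_card_2[OF sub _ nz] by (auto simp: copies_P3)
      then show False using S by blast
    next
      assume "card S = 4"
      then have "S \<in> ?P5 \<union> ?P33"
        using \<tau>_card_4[OF sub _ nz] l_ge_5 by (auto simp: copies_P5 copies_2P3)
      then show False using S by blast
    qed
  qed
  ultimately have "sum ?g (Pow {..<l} - {{..<l}}) = sum ?g ?T"
    by (intro sum.mono_neutral_right) auto
  also have "\<dots> = sum ?g {{}} + (sum ?g ?P3 + (sum ?g ?P5 + (sum ?g ?P33 + sum ?g large_sets)))"
  proof -
    \<comment> \<open>Cardinality separates all these families except the copies of
      \<open>P_5\<close> and \<open>2P_3\<close>, for which \<open>copies_disjoint\<close> is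
      used.\<close>
    have "?P33 \<inter> large_sets = {}" "?P5 \<inter> large_sets = {}" "?P3 \<inter> large_sets = {}"
      "?P3 \<inter> ?P5 = {}" "?P3 \<inter> ?P33 = {}" "{} \<notin> ?P3" "{} \<notin> ?P5" "{} \<notin> ?P33" "{} \<notin> large_sets"
      using card_copies_P3 card_copies_P5[OF l_ge_5] card_copies_2P3
      by (fastforce simp: large_sets_def)+
    then show ?thesis using copies_disjoint fin finite_copies
      by (simp add: sum.union_disjoint Int_Un_distrib)
  qed
  also have "sum ?g {{}} = 1" by (simp add: weight_def \<tau>_empty)
  also have "sum ?g ?P3 = 0"
    using sum_copies[OF \<tau>_copies(1) card_copies_P3 cherry_P3] P3_zero by simp
  also have "sum ?g ?P5 = 2 ^ 4 * path_density 2 * \<delta> ^ 4 * P5_count"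
    unfolding P5_count_def by (rule sum_copies[OF \<tau>_copies(2) card_copies_P5[OF l_ge_5] cherry_P5])
  also have "sum ?g ?P33 = 2 ^ 4 * (path_density 1)\<^sup>2 * \<delta> ^ 4 * P33_count"
    unfolding P33_count_def by (rule sum_copies[OF \<tau>_copies(3) card_copies_2P3 cherry_2P3])
  finally show ?thesis by (simp add: quartic_def algebra_simps)
qed

lemma expansion:
  "(\<Sum>S \<in> Pow {..<l}. weight S * \<tau> l S * \<delta> ^ card S)
    = 1 + quartic * \<delta> ^ 4 + (\<Sum>S \<in> large_sets. weight S * \<tau> l S * \<delta> ^ card S)
      + weight {..<l} * \<tau> l {..<l} * \<delta> ^ l"
proof -
  have "(\<Sum>S \<in> Pow {..<l}. weight S * \<tau> l S * \<delta> ^ card S)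
      = weight {..<l} * \<tau> l {..<l} * \<delta> ^ card {..<l}
        + (\<Sum>S \<in> Pow {..<l} - {{..<l}}. weight S * \<tau> l S * \<delta> ^ card S)"
    by (rule sum.remove) auto
  then show ?thesis unfolding expansion_proper by simp
qed

text \<open>One factor \<open>2 ^ l\<close> bounds the weights, the other the number of
  subsets.\<close>

lemma large_sets_bound:
  assumes "kernel_radius n b \<le> \<eta> * real n" "0 \<le> \<eta>" "\<eta> \<le> 1"
  shows "\<bar>\<Sum>S \<in> large_sets. weight S * \<tau> l S\<bar> \<le> 4 ^ l * (\<eta> * path_density 2)"
proof -
  have nn: "0 \<le> \<eta> * path_density 2" using assms path_density_nonneg by simp
  have "\<bar>\<Sum>S \<in> large_sets. weight S * \<tau> l S\<bar> \<le> (\<Sum>S \<in> large_sets. \<bar>weight S * \<tau> l S\<bar>)" by (rule sum_abs)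
  also have "\<dots> \<le> (\<Sum>S \<in> large_sets. 2 ^ l * (\<eta> * path_density 2))"
  proof (rule sum_mono)
    fix S assume "S \<in> large_sets"
    then have S: "S \<subseteq> {..<l}" "S \<noteq> {..<l}" "5 \<le> card S" by (auto simp: large_sets_def)
    have "\<bar>weight S\<bar> \<le> 2 ^ l"
      using abs_weight[OF finite_subset[OF S(1)]] card_mono[OF _ S(1)] by simp
    then show "\<bar>weight S * \<tau> l S\<bar> \<le> 2 ^ l * (\<eta> * path_density 2)"
      unfolding abs_mult using abs_\<tau>_le[OF S assms] nn by (intro mult_mono) auto
  qed
  also have "\<dots> \<le> 2 ^ l * (2 ^ l * (\<eta> * path_density 2))"
  proof -
    have "card large_sets \<le> card (Pow {..<l})" by (rule card_mono) (auto simp: large_sets_def)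
    then have "real (card large_sets) \<le> 2 ^ l" by (simp add: card_Pow)
    then show ?thesis unfolding sum_constant using nn by (intro mult_right_mono) auto
  qed
  also have "\<dots> = 4 ^ l * (\<eta> * path_density 2)"
    by (simp add: power_mult_distrib[symmetric])
  finally show ?thesis .
qed

lemma full_cycle:
  "weight {..<l} * \<tau> l {..<l} = (if odd l then 0 else
     (- 1) ^ (card R + l div 2) * ((\<Sum>x<n. \<Sum>y<n. (W (l div 2) x y)\<^sup>2) * (2 / real n) ^ l))"
proof -
  have "\<tau> l {..<l} = (\<Sum>x<n. W l x x) / real n ^ l"
    using hom_sum_cycle[of l n b] l_ge_5 by (simp add: \<tau>_def cycle_arcs_def)
  moreover have "weight {..<l} = (- 1) ^ card R * 2 ^ l"
    by (simp add: weight_def prod_orient)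
  ultimately show ?thesis
    using closed_walks_odd[of l] closed_walks_even[of "l div 2"]
    by (auto simp: power_add power_divide)
qed

text \<open>With \<open>a_2 = d + a_1^2\<close> and \<open>d \<ge> 0\<close>, the form
  \<open>p a_2 + q a_1^2\<close> equals \<open>p d + (p + q) a_1^2\<close>; after multiplication by
  \<open>s\<close> both coefficients are at least 1.\<close>

lemma quartic_lower_bound:
  fixes s :: int
  assumes "1 \<le> s * P5_count" "1 \<le> s * (P5_count + P33_count)"
  shows "16 * path_density 2 \<le> s * quartic"
proof -
  define d where "d = path_density 2 - (path_density 1)\<^sup>2"
  have d: "0 \<le> d" using path_density_1_square_le by (simp add: d_def)
  have "1 \<le> real_of_int (s * P5_count)" "1 \<le> real_of_int (s * (P5_count + P33_count))"
    using assms by linarith+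
  then have "1 * d + 1 * (path_density 1)\<^sup>2
      \<le> real_of_int (s * P5_count) * d + real_of_int (s * (P5_count + P33_count)) * (path_density 1)\<^sup>2"
    using d by (intro add_mono mult_right_mono) auto
  then show ?thesis by (simp add: quartic_def d_def algebra_simps)
qed

end

section \<open>Small perturbations\<close>

lemma skew_part_kernel:
  assumes "A \<in> carrier_mat n n"
  shows "lambda_max (skew_part n A) = kernel_radius n (\<lambda>x y. A $$ (x, y) - 1 / 2)"
  unfolding lambda_max_def kernel_radius_def skew_part_def
  by (rule arg_cong[where f = spectral_radius], rule eq_matI) (use assms in auto)

definition perturbation :: "nat \<Rightarrow> (nat \<Rightarrow> nat \<Rightarrow> real) \<Rightarrow> real \<Rightarrow> real mat" where
  "perturbation n b \<delta> = mat n n (\<lambda>(x, y). 1 / 2 + \<delta> * b x y)"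

context skew_kernel
begin

lemma perturbation_tournament:
  assumes "\<And>x y. x < n \<Longrightarrow> y < n \<Longrightarrow> \<bar>b x y\<bar> \<le> 1 / 2" "0 \<le> \<delta>" "\<delta> \<le> 1"
  shows "weighted_tournament n (perturbation n b \<delta>)"
proof -
  have "\<bar>\<delta> * b x y\<bar> \<le> 1 / 2" if "x < n" "y < n" for x y
    using mult_mono[of \<delta> 1 "\<bar>b x y\<bar>" "1 / 2"] assms that by (simp add: abs_mult)
  then have "0 \<le> 1 / 2 + \<delta> * b x y \<and> 1 / 2 + \<delta> * b x y \<le> 1"
    if "x < n" "y < n" for x y
    using abs_le_iff[of "\<delta> * b x y" "1 / 2"] that by fastforce
  moreover have "(1 / 2 + \<delta> * b x y) + (1 / 2 + \<delta> * b y x) = 1" if "x < n" "y < n" for x y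
    unfolding skew[OF that] by simp
  ultimately show ?thesis
    using n_pos by (simp add: weighted_tournament_def perturbation_def)
qed

lemma perturbation_radius:
  assumes "0 < \<delta>"
  shows "lambda_max (skew_part n (perturbation n b \<delta>)) \<le> \<delta> * kernel_radius n b"
proof -
  let ?B = "mat n n (\<lambda>(x, y). complex_of_real (b x y))"
  have "map_mat complex_of_real (skew_part n (perturbation n b \<delta>)) = complex_of_real \<delta> \<cdot>\<^sub>m ?B"
    by (rule eq_matI) (auto simp: skew_part_def perturbation_def)
  then show ?thesis unfolding lambda_max_def kernel_radius_def
    using spectral_radius_smult_le[of ?B n \<delta>] n_pos assms by simp
qed

end

lemma sgn_add_small: "\<bar>r\<bar> < \<bar>x\<bar> \<Longrightarrow> sgn (x + r) = sgn x" for x r :: real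
  by (auto simp: sgn_if abs_if split: if_splits)

context cycle_kernel
begin

lemma hom_density_perturbation:
  "2 ^ l * hom_density C n (perturbation n b \<delta>)
    = (\<Sum>S \<in> Pow {..<l}. weight S * \<tau> l S * \<delta> ^ card S)"
proof -
  have "2 ^ l * hom_density C n (perturbation n b \<delta>) = (\<Sum>S \<in> Pow {..<l}.
      weight S * (hom_sum n (\<lambda>x y. \<delta> * b x y) {..<l} (cycle_arcs l S) / real n ^ l))"
  proof (rule hom_density_expansion)
    fix x y assume "x < n" "y < n"
    then show "\<delta> * b y x = - (\<delta> * b x y)" using skew[of x y] by (simp only: mult_minus_right)
  qed (simp_all add: n_pos perturbation_def)
  also have "\<dots> = (\<Sum>S \<in> Pow {..<l}. weight S * \<tau> l S * \<delta> ^ card S)"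
  proof (intro sum.cong refl)
    fix S
    have "hom_sum n (\<lambda>x y. \<delta> * b x y) {..<l} (cycle_arcs l S)
        = \<delta> ^ card S * hom_sum n b {..<l} (cycle_arcs l S)"
      by (simp add: hom_sum_def cycle_arcs_def prod_arcs prod.distrib sum_distrib_left)
    then show "weight S * (hom_sum n (\<lambda>x y. \<delta> * b x y) {..<l} (cycle_arcs l S) / real n ^ l)
        = weight S * \<tau> l S * \<delta> ^ card S" by (simp add: \<tau>_def)
  qed
  finally show ?thesis .
qed

text \<open>If \<open>c * \<delta> ^ k\<close> is the lowest nonconstant term, it decides the sign
  of the deviation for small \<open>\<delta>\<close>.\<close>

lemma local_violation:
  assumes b: "\<And>x y. x < n \<Longrightarrow> y < n \<Longrightarrow> \<bar>b x y\<bar> \<le> 1 / 2"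
    and low: "\<And>\<delta>. (\<Sum>S \<in> Pow {..<l}. weight S * \<tau> l S * \<delta> ^ card S)
        = 1 + c * \<delta> ^ k + (\<Sum>S \<in> F. weight S * \<tau> l S * \<delta> ^ card S)"
    and F: "finite F" "\<And>S. S \<in> F \<Longrightarrow> k < card S" and "\<epsilon> > 0" "c \<noteq> 0"
  shows "\<exists>A. weighted_tournament n A \<and> lambda_max (skew_part n A) \<le> \<epsilon> * real n \<and>
    sgn (hom_density C n A - (1 / 2) ^ l) = sgn c"
proof -
  define M where "M = (\<Sum>S \<in> F. \<bar>weight S * \<tau> l S\<bar>)"
  have M: "0 \<le> M" by (simp add: M_def sum_nonneg)
  \<comment> \<open>The three bounds keep the entries in \<open>[0, 1]\<close>, the remainder at
    most half of the leading term, and the spectral radius within \<open>\<epsilon> * n\<close>;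
    adding 1 keeps the denominators positive.\<close>
  define \<delta> where "\<delta> = min 1 (min (\<bar>c\<bar> / (2 * (M + 1))) (\<epsilon> * real n / (kernel_radius n b + 1)))"
  have \<delta>: "0 < \<delta>" "\<delta> \<le> 1" "\<delta> \<le> \<bar>c\<bar> / (2 * (M + 1))" "\<delta> \<le> \<epsilon> * real n / (kernel_radius n b + 1)"
    using M \<open>\<epsilon> > 0\<close> \<open>c \<noteq> 0\<close> n_pos kernel_radius_nonneg by (auto simp: \<delta>_def add_nonneg_pos)
  let ?A = "perturbation n b \<delta>"
  have "\<delta> * kernel_radius n b \<le> \<delta> * (kernel_radius n b + 1)" using \<delta> by simp
  also have "\<dots> \<le> \<epsilon> * real n"
    using \<delta>(4) kernel_radius_nonneg by (simp add: pos_le_divide_eq add_nonneg_pos)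
  finally have radius: "lambda_max (skew_part n ?A) \<le> \<epsilon> * real n"
    using perturbation_radius[OF \<delta>(1)] by simp
  define r where "r = (\<Sum>S \<in> F. weight S * \<tau> l S * \<delta> ^ card S)"
  have "\<bar>r\<bar> \<le> (\<Sum>S \<in> F. \<bar>weight S * \<tau> l S * \<delta> ^ card S\<bar>)" unfolding r_def by (rule sum_abs)
  also have "\<dots> \<le> (\<Sum>S \<in> F. \<bar>weight S * \<tau> l S\<bar> * \<delta> ^ Suc k)"
  proof (rule sum_mono)
    fix S assume "S \<in> F"
    then have "\<delta> ^ card S \<le> \<delta> ^ Suc k" using F(2)[of S] \<delta> by (intro power_decreasing) auto
    then show "\<bar>weight S * \<tau> l S * \<delta> ^ card S\<bar> \<le> \<bar>weight S * \<tau> l S\<bar> * \<delta> ^ Suc k"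
      using \<delta> by (simp only: abs_mult abs_of_nonneg zero_le_power less_imp_le) (intro mult_left_mono, auto)
  qed
  also have "\<dots> = (M * \<delta>) * \<delta> ^ k" by (simp add: M_def sum_distrib_right mult.assoc)
  also have "\<dots> < \<bar>c\<bar> * \<delta> ^ k"
  proof -
    have "M * \<delta> \<le> (M + 1) * (\<bar>c\<bar> / (2 * (M + 1)))" using \<delta> M by (intro mult_mono) auto
    also have "\<dots> = \<bar>c\<bar> / 2" using M by (simp add: field_simps)
    also have "\<dots> < \<bar>c\<bar>" using \<open>c \<noteq> 0\<close> by simp
    finally show ?thesis using \<delta> by simp
  qed
  finally have "\<bar>r\<bar> < \<bar>c * \<delta> ^ k\<bar>" using \<delta> by (simp add: abs_mult)
  then have "sgn (c * \<delta> ^ k + r) = sgn (c * \<delta> ^ k)" by (rule sgn_add_small)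
  also have "\<dots> = sgn c" using \<delta> by (simp add: sgn_mult)
  finally have sgn: "sgn (c * \<delta> ^ k + r) = sgn c" .
  have "2 ^ l * hom_density C n ?A = 1 + c * \<delta> ^ k + r"
    unfolding hom_density_perturbation low r_def ..
  then have "hom_density C n ?A - (1 / 2) ^ l = (1 / 2) ^ l * (c * \<delta> ^ k + r)"
    by (simp add: field_simps power_divide)
  then have "sgn (hom_density C n ?A - (1 / 2) ^ l) = sgn c"
    using sgn by (simp add: sgn_mult)
  then show ?thesis using perturbation_tournament[OF b] \<delta> radius by (meson less_imp_le)
qed

lemma quartic_violation:
  assumes "\<And>x y. x < n \<Longrightarrow> y < n \<Longrightarrow> \<bar>b x y\<bar> \<le> 1 / 2" and "quartic \<noteq> 0" "\<epsilon> > 0"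
  shows "\<exists>A. weighted_tournament n A \<and> lambda_max (skew_part n A) \<le> \<epsilon> * real n \<and>
    sgn (hom_density C n A - (1 / 2) ^ l) = sgn quartic"
proof (rule local_violation[where k = 4 and F = "insert {..<l} large_sets"])
  have fin: "finite large_sets"
    by (rule finite_subset[of _ "Pow {..<l}"]) (auto simp: large_sets_def)
  then show "finite (insert {..<l} large_sets)" by simp
  show "4 < card S" if "S \<in> insert {..<l} large_sets" for S
    using that l_ge_5 by (auto simp: large_sets_def)
  fix \<delta>
  show "(\<Sum>S \<in> Pow {..<l}. weight S * \<tau> l S * \<delta> ^ card S)
      = 1 + quartic * \<delta> ^ 4 + (\<Sum>S \<in> insert {..<l} large_sets. weight S * \<tau> l S * \<delta> ^ card S)"
    unfolding expansion by (subst sum.insert) (auto simp: fin, simp add: large_sets_def)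
qed (use assms in auto)

text \<open>If \<open>a_1 = 0\<close>, then \<open>B 1 = 0\<close> and all further
  \<open>a_m\<close> vanish. Every nonempty proper subset then has density 0, and only the full
  cycle survives.\<close>

lemma cycle_violation:
  assumes "\<And>x y. x < n \<Longrightarrow> y < n \<Longrightarrow> \<bar>b x y\<bar> \<le> 1 / 2" and "weight {..<l} * \<tau> l {..<l} \<noteq> 0" "\<epsilon> > 0"
    and balanced: "path_density 1 = 0"
  shows "\<exists>A. weighted_tournament n A \<and> lambda_max (skew_part n A) \<le> \<epsilon> * real n \<and>
    sgn (hom_density C n A - (1 / 2) ^ l) = sgn (weight {..<l} * \<tau> l {..<l})"
proof (rule local_violation[where k = l and F = "{}"])
  fix \<delta> :: real
  have zero: "\<tau> l S = 0" if S: "S \<subseteq> {..<l}" "S \<noteq> {}" "S \<noteq> {..<l}" for S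
  proof (rule ccontr)
    assume nz: "\<tau> l S \<noteq> 0"
    obtain m S' where m: "0 < m" "\<tau> l S = (- 1) ^ m * path_density m * \<tau> l S'"
      using \<tau>_even_run[OF S nz] by blast
    \<comment> \<open>The exact ratio of radius to \<open>n\<close> serves as \<open>\<eta>\<close>;
      no smallness is required here.\<close>
    have "path_density (m - 1 + 1) \<le> ((kernel_radius n b / real n)\<^sup>2) ^ (m - 1) * path_density 1"
      using n_pos by (intro path_density_le) simp
    then have "path_density m = 0" using balanced path_density_nonneg[of m] m(1) by simp
    then show False using m nz by simp
  qed
  have nonempty: "{} \<noteq> {..<l}" using l_ge_5 by (metis lessThan_empty_iff not_numeral_le_zero)
  have "(\<Sum>S \<in> Pow {..<l}. weight S * \<tau> l S * \<delta> ^ card S)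
      = (\<Sum>S \<in> {{}, {..<l}}. weight S * \<tau> l S * \<delta> ^ card S)"
    by (rule sum.mono_neutral_right) (auto simp: zero)
  also have "\<dots> = 1 + weight {..<l} * \<tau> l {..<l} * \<delta> ^ l"
    using nonempty by (subst sum.insert) (auto simp: weight_def \<tau>_empty)
  finally show "(\<Sum>S \<in> Pow {..<l}. weight S * \<tau> l S * \<delta> ^ card S)
      = 1 + weight {..<l} * \<tau> l {..<l} * \<delta> ^ l + (\<Sum>S \<in> {}. weight S * \<tau> l S * \<delta> ^ card S)" by simp
qed (use assms in auto)

end

section \<open>Test kernels: a single edge and the cyclic triangle\<close>

context skew_kernel
begin

lemma row_weight_1: "x < n \<Longrightarrow> row_weight 1 x = (\<Sum>y<n. b x y)"
  by (simp add: row_weight_def walk_weight_1 del: walk_weight.simps(2))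

lemma row_weight_Suc: "x < n \<Longrightarrow> row_weight (Suc k) x = (\<Sum>y<n. b x y * row_weight k y)"
proof -
  assume x: "x < n"
  have "row_weight (Suc k) x = (\<Sum>y<n. \<Sum>z<n. b x z * W k z y)"
    unfolding row_weight_def
    using walk_weight_add[of _ n b "Suc 0" k x] x
    by (simp add: walk_weight_1 del: walk_weight.simps(2))
  also have "\<dots> = (\<Sum>y<n. b x y * row_weight k y)"
    by (subst sum.swap) (simp add: row_weight_def sum_distrib_left)
  finally show ?thesis .
qed

text \<open>A nilpotent skew-symmetric matrix is zero. If \<open>B^(m+2) = 0\<close>, then
  \<open>B^(2m+2) = 0\<close>; its trace is up to sign the squared Frobenius norm of
  \<open>B^(m+1)\<close>, so the exponent can be lowered.\<close>

lemma walk_weights_zero: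
  assumes "\<And>x y. x < n \<Longrightarrow> y < n \<Longrightarrow> W (Suc m) x y = 0" "x < n" "y < n"
  shows "b x y = 0"
  using assms
proof (induction m arbitrary: x y)
  case 0
  then show ?case using walk_weight_1[of x n b y] by simp
next
  case (Suc m)
  have "W (2 * Suc m) x x = 0" if "x < n" for x
    using walk_weight_add[OF that, of b "Suc (Suc m)" m x] Suc.prems(1) that
    by (simp add: mult_2 del: walk_weight.simps(2))
  then have "(\<Sum>x<n. \<Sum>y<n. (W (Suc m) x y)\<^sup>2) = 0"
    using closed_walks_even[of "Suc m"] by (simp del: walk_weight.simps(2))
  then have "W (Suc m) x y = 0" if "x < n" "y < n" for x y
    using that by (simp add: sum_nonneg_eq_0_iff sum_nonneg del: walk_weight.simps(2))
  then show ?case using Suc.IH Suc.prems(2,3) by blast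
qed

end

definition edge_kernel :: "nat \<Rightarrow> nat \<Rightarrow> real" where
  "edge_kernel x y = (if x = 0 \<and> y = 1 then 1 / 2 else if x = 1 \<and> y = 0 then - 1 / 2 else 0)"

definition triangle_kernel :: "nat \<Rightarrow> nat \<Rightarrow> real" where
  "triangle_kernel x y = (if y = Suc x mod 3 then 1 / 2 else if x = Suc y mod 3 then - 1 / 2 else 0)"

lemma kernel_bounds:
  "\<bar>edge_kernel x y\<bar> \<le> 1 / 2" "\<bar>triangle_kernel x y\<bar> \<le> 1 / 2"
  by (auto simp: edge_kernel_def triangle_kernel_def)

text \<open>Here \<open>B 1 = (1/2, -1/2, 0, ...)\<close> and
  \<open>B^2 1 = (-1/4, -1/4, 0, ...)\<close>, with squared lengths \<open>1/2\<close> and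
  \<open>1/8\<close>.\<close>

lemma edge_kernel_density:
  assumes "2 \<le> n"
  shows "skew_kernel n edge_kernel"
    and "skew_kernel.path_density n edge_kernel 2 = 1 / (8 * real n ^ 5)"
    and "(skew_kernel.path_density n edge_kernel 1)\<^sup>2 = 2 / real n * (1 / (8 * real n ^ 5))"
proof -
  show "skew_kernel n edge_kernel"
    using assms by unfold_locales (auto simp: edge_kernel_def)
  then interpret skew_kernel n edge_kernel .
  have sum2: "(\<Sum>y<n. f y) = f 0 + f 1" if "\<And>y. 2 \<le> y \<Longrightarrow> f y = 0" for f :: "nat \<Rightarrow> real"
  proof -
    have "(\<Sum>y<n. f y) = (\<Sum>y \<in> {0, 1}. f y)"
      using assms that by (intro sum.mono_neutral_right) auto
    then show ?thesis by simp
  qed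
  have r1: "row_weight 1 x = (if x = 0 then 1 / 2 else if x = 1 then - 1 / 2 else 0)" if "x < n" for x
    unfolding row_weight_1[OF that] by (subst sum2) (auto simp: edge_kernel_def)
  have r2: "row_weight 2 x = (if x < 2 then - 1 / 4 else 0)" if "x < n" for x
  proof -
    have "row_weight 2 x = (\<Sum>y<n. edge_kernel x y * row_weight 1 y)"
      using row_weight_Suc[OF that, of 1] by (simp add: numeral_2_eq_2)
    also have "\<dots> = edge_kernel x 0 * row_weight 1 0 + edge_kernel x 1 * row_weight 1 1"
      by (rule sum2) (simp add: edge_kernel_def)
    also have "\<dots> = (if x < 2 then - 1 / 4 else 0)"
      using r1[of 0] r1[of 1] assms by (auto simp: edge_kernel_def)
    finally show ?thesis .
  qed
  have "row_norm 1 = (\<Sum>x<n. (if x = 0 then 1 / 2 else if x = 1 then - 1 / 2 else 0)\<^sup>2)"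
    unfolding row_norm_def by (intro sum.cong refl) (simp only: r1 lessThan_iff)
  also have "\<dots> = 1 / 2" by (subst sum2) (auto simp: power2_eq_square)
  finally have n1: "row_norm 1 = 1 / 2" .
  have "row_norm 2 = (\<Sum>x<n. (if x < 2 then - 1 / 4 else 0)\<^sup>2)"
    unfolding row_norm_def by (intro sum.cong refl) (simp only: r2 lessThan_iff)
  also have "\<dots> = 1 / 8" by (subst sum2) (auto simp: power2_eq_square)
  finally have n2: "row_norm 2 = 1 / 8" .
  show "path_density 2 = 1 / (8 * real n ^ 5)" unfolding path_density_def n2 by simp
  show "(path_density 1)\<^sup>2 = 2 / real n * (1 / (8 * real n ^ 5))"
    unfolding path_density_def n1 by (simp add: power_divide power_mult_distrib eval_nat_numeral)
qed

lemma triangle_kernel_balanced: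
  shows "skew_kernel 3 triangle_kernel" and "skew_kernel.path_density 3 triangle_kernel 1 = 0"
proof -
  have cases: "x = 0 \<or> x = 1 \<or> x = 2" if "x < 3" for x :: nat using that by linarith
  have entries: "triangle_kernel 0 0 = 0" "triangle_kernel 0 1 = 1 / 2" "triangle_kernel 0 2 = - 1 / 2"
    "triangle_kernel 1 0 = - 1 / 2" "triangle_kernel 1 1 = 0" "triangle_kernel 1 2 = 1 / 2"
    "triangle_kernel 2 0 = 1 / 2" "triangle_kernel 2 1 = - 1 / 2" "triangle_kernel 2 2 = 0"
    by (simp_all add: triangle_kernel_def)
  show "skew_kernel 3 triangle_kernel"
  proof
    fix x y :: nat assume "x < 3" "y < 3"
    from cases[OF this(1)] cases[OF this(2)] show "triangle_kernel y x = - triangle_kernel x y"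
      by (elim disjE; simp only: entries; simp)
  qed simp
  then interpret skew_kernel 3 triangle_kernel .
  have "row_weight 1 x = 0" if "x < 3" for x
  proof -
    have "{..<3} = {0, 1, 2 :: nat}" using cases by auto
    then have "row_weight 1 x = triangle_kernel x 0 + (triangle_kernel x 1 + triangle_kernel x 2)"
      unfolding row_weight_1[OF that] by simp
    with cases[OF that] show ?thesis by (elim disjE; simp only: entries; simp)
  qed
  then show "path_density 1 = 0"
    by (simp add: path_density_def row_norm_def)
qed

section \<open>The three cases of the theorem\<close>

locale cycle_statement = oriented_cycle +
  assumes P3_zero: "signed_count (directed_path 3) C = 0"
    and P5_nonzero: "P5_count \<noteq> 0" and sum_nonzero: "P5_count + P33_count \<noteq> 0"
begin

lemma l_ge_5: "5 \<le> l"
  using length_ge_5 P5_nonzero by (simp add: P5_count_def)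

lemma cycle_kernelI: "skew_kernel n b \<Longrightarrow> cycle_kernel l R n b"
  using oriented_cycle_axioms l_ge_5 P3_zero by (simp add: cycle_kernel_def cycle_kernel_axioms_def)

text \<open>Both positive cases at once: \<open>s = 1\<close> for LTS and \<open>s = - 1\<close> for
  LTAS. The quartic term is at least \<open>16 * a_2\<close> in direction \<open>s\<close>, the
  large sets cost at most \<open>a_2\<close>, and the full cycle is zero or has sign
  \<open>s\<close>.\<close>

lemma locally_signed:
  fixes s :: int
  assumes s: "\<bar>s\<bar> = 1" "1 \<le> s * P5_count" "1 \<le> s * (P5_count + P33_count)"
    and parity: "even l \<Longrightarrow> s = (- 1) ^ (card R + l div 2)"
  shows "\<exists>\<epsilon> > 0. \<forall>n A. weighted_tournament n A \<and> lambda_max (skew_part n A) \<le> \<epsilon> * real n \<longrightarrow>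
        0 \<le> s * (hom_density C n A - (1 / 2) ^ card (parcs C))"
\<comment> \<open>This radius cancels the factor \<open>4 ^ l\<close> in
  \<open>large_sets_bound\<close>.\<close>
proof (intro exI[of _ "1 / 4 ^ l"] conjI allI impI)
  fix n A
  assume A: "weighted_tournament n A \<and> lambda_max (skew_part n A) \<le> 1 / 4 ^ l * real n"
  let ?b = "\<lambda>x y. A $$ (x, y) - 1 / 2"
  have wt: "0 < n" "A \<in> carrier_mat n n" "\<And>x y. x < n \<Longrightarrow> y < n \<Longrightarrow> A $$ (x, y) + A $$ (y, x) = 1"
    using A by (auto simp: weighted_tournament_def)
  have skew: "?b y x = - ?b x y" if "x < n" "y < n" for x y
    using wt(3)[OF that] by simp
  have "skew_kernel n ?b" using wt(1) skew by unfold_locales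
  then interpret cycle_kernel l R n ?b by (rule cycle_kernelI)
  have radius: "kernel_radius n ?b \<le> 1 / 4 ^ l * real n"
    using A skew_part_kernel[OF wt(2)] by simp
  have "2 ^ l * hom_density C n A = (\<Sum>S \<in> Pow {..<l}. weight S * \<tau> l S)"
    unfolding \<tau>_def by (rule hom_density_expansion[where b = ?b, OF wt(1) _ skew]) simp_all
  also have "\<dots> = 1 + quartic + (\<Sum>S \<in> large_sets. weight S * \<tau> l S) + weight {..<l} * \<tau> l {..<l}"
    using expansion[of 1] by simp
  finally have eq: "2 ^ l * hom_density C n A - 1
      = quartic + (\<Sum>S \<in> large_sets. weight S * \<tau> l S) + weight {..<l} * \<tau> l {..<l}" by simp
  have "\<bar>\<Sum>S \<in> large_sets. weight S * \<tau> l S\<bar> \<le> 4 ^ l * (1 / 4 ^ l * path_density 2)"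
    by (rule large_sets_bound[OF radius]) auto
  then have "\<bar>s * (\<Sum>S \<in> large_sets. weight S * \<tau> l S)\<bar> \<le> path_density 2"
    using s(1) by (simp add: abs_mult flip: of_int_abs)
  moreover have "16 * path_density 2 \<le> s * quartic" using quartic_lower_bound[OF s(2,3)] .
  moreover have "0 \<le> s * (weight {..<l} * \<tau> l {..<l})"
    unfolding full_cycle using parity
    by (auto simp: sum_nonneg simp flip: mult.assoc power_mult_distrib)
  ultimately have nonneg: "0 \<le> s * (2 ^ l * hom_density C n A - 1)"
    unfolding eq using path_density_nonneg[of 2] by (simp add: distrib_left)
  have "hom_density C n A - (1 / 2) ^ l = (1 / 2) ^ l * (2 ^ l * hom_density C n A - 1)"
    by (simp add: power_divide field_simps)
  moreover have "0 \<le> (1 / 2) ^ l * (s * (2 ^ l * hom_density C n A - 1))"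
    by (rule mult_nonneg_nonneg[OF _ nonneg]) simp
  ultimately show "0 \<le> s * (hom_density C n A - (1 / 2) ^ card (parcs C))"
    unfolding card_parcs_C by (metis mult.left_commute)
qed simp

text \<open>A deviation of sign \<open>- 1\<close> at every scale refutes LTS, and one of sign
  \<open>1\<close> refutes LTAS.\<close>

definition realises :: "real \<Rightarrow> bool" where
  "realises s \<longleftrightarrow> (\<forall>\<epsilon> > 0. \<exists>n A. weighted_tournament n A \<and>
     lambda_max (skew_part n A) \<le> \<epsilon> * real n \<and> sgn (hom_density C n A - (1 / 2) ^ l) = s)"

lemma not_LTS:
  assumes "realises (- 1)"
  shows "\<not> LTS C"
proof
  assume "LTS C"
  then obtain \<epsilon> where "\<epsilon> > 0" and \<epsilon>: "\<And>n A. weighted_tournament n A \<Longrightarrow>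
      lambda_max (skew_part n A) \<le> \<epsilon> * real n \<Longrightarrow> (1 / 2) ^ l \<le> hom_density C n A"
    unfolding LTS_def card_parcs_C by blast
  then obtain n A where "weighted_tournament n A" "lambda_max (skew_part n A) \<le> \<epsilon> * real n"
    "sgn (hom_density C n A - (1 / 2) ^ l) = - 1"
    using assms unfolding realises_def by blast
  then show False using \<epsilon>[of n A] by (simp add: sgn_if split: if_splits)
qed

lemma not_LTAS:
  assumes "realises 1"
  shows "\<not> LTAS C"
proof
  assume "LTAS C"
  then obtain \<epsilon> where "\<epsilon> > 0" and \<epsilon>: "\<And>n A. weighted_tournament n A \<Longrightarrow>
      lambda_max (skew_part n A) \<le> \<epsilon> * real n \<Longrightarrow> hom_density C n A \<le> (1 / 2) ^ l"
    unfolding LTAS_def card_parcs_C by blast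
  then obtain n A where "weighted_tournament n A" "lambda_max (skew_part n A) \<le> \<epsilon> * real n"
    "sgn (hom_density C n A - (1 / 2) ^ l) = 1"
    using assms unfolding realises_def by blast
  then show False using \<epsilon>[of n A] by (simp add: sgn_if split: if_splits)
qed

text \<open>For a single edge \<open>a_1^2 = (2/n) a_2\<close>, so the quartic term is a positive
  multiple of \<open>p n + 2 q\<close>.\<close>

lemma realises_edge:
  assumes "2 \<le> n" "P5_count * int n + 2 * P33_count \<noteq> 0"
  shows "realises (sgn (real_of_int (P5_count * int n + 2 * P33_count)))"
proof -
  interpret cycle_kernel l R n edge_kernel
    using edge_kernel_density(1)[OF assms(1)] by (rule cycle_kernelI)
  have "quartic = 2 / real n ^ 6 * real_of_int (P5_count * int n + 2 * P33_count)"
    unfolding quartic_def edge_kernel_density(2,3)[OF assms(1)]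
    using assms(1) by (simp add: field_simps eval_nat_numeral)
  then have "quartic \<noteq> 0" "sgn quartic = sgn (real_of_int (P5_count * int n + 2 * P33_count))"
    using assms by (auto simp: sgn_mult simp del: of_int_add of_int_mult)
  then show ?thesis
    using quartic_violation unfolding realises_def by (metis kernel_bounds(1))
qed

text \<open>The Frobenius norm in \<open>full_cycle\<close> is positive, since otherwise nilpotency
  would force the triangle kernel to vanish.\<close>

lemma realises_triangle:
  assumes "even l"
  shows "realises ((- 1) ^ (card R + l div 2))"
proof -
  interpret cycle_kernel l R 3 triangle_kernel
    using triangle_kernel_balanced(1) by (rule cycle_kernelI)
  let ?Q = "\<Sum>x<3. \<Sum>y<3. (W (l div 2) x y)\<^sup>2"
  obtain m where m: "l div 2 = Suc m" using l_ge_5 by (cases "l div 2") auto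
  have "?Q \<noteq> 0"
  proof
    assume "?Q = 0"
    then have "W (Suc m) x y = 0" if "x < 3" "y < 3" for x y
      using that unfolding m by (simp add: sum_nonneg_eq_0_iff sum_nonneg del: walk_weight.simps(2))
    then have "triangle_kernel 0 1 = 0" by (intro walk_weights_zero) auto
    then show False by (simp add: triangle_kernel_def)
  qed
  then have "0 < ?Q" by (simp add: sum_nonneg order_less_le)
  then have full: "weight {..<l} * \<tau> l {..<l} \<noteq> 0"
    "sgn (weight {..<l} * \<tau> l {..<l}) = (- 1) ^ (card R + l div 2)"
    unfolding full_cycle using assms by (auto simp: sgn_mult)
  show ?thesis unfolding realises_def
  proof (intro allI impI)
    fix \<epsilon> :: real assume "\<epsilon> > 0"
    then show "\<exists>n A. weighted_tournament n A \<and> lambda_max (skew_part n A) \<le> \<epsilon> * real n \<and>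
        sgn (hom_density C n A - (1 / 2) ^ l) = (- 1) ^ (card R + l div 2)"
      using cycle_violation[OF kernel_bounds(2) full(1) _ triangle_kernel_balanced(2)] unfolding full(2) by blast
  qed
qed

lemma realises_sum: "realises (sgn (real_of_int (P5_count + P33_count)))"
proof -
  have "P5_count * int 2 + 2 * P33_count = 2 * (P5_count + P33_count)" by simp
  then have "realises (sgn (real_of_int (2 * (P5_count + P33_count))))"
    using realises_edge[of 2] sum_nonzero by (metis mult_eq_0_iff order_refl zero_neq_numeral)
  then show ?thesis unfolding of_int_mult sgn_mult by simp
qed

lemma realises_P5: "realises (sgn (real_of_int P5_count))"
proof -
  \<comment> \<open>Since \<open>\<bar>p\<bar> \<ge> 1\<close>, this \<open>n\<close> exceeds
    \<open>2 \<bar>q\<bar>\<close>, so \<open>p n\<close> dominates \<open>2 q\<close>; it is also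
    at least 2.\<close>
  define n where "n = nat (2 * \<bar>P33_count\<bar> + 2)"
  have n: "int n = 2 * \<bar>P33_count\<bar> + 2" by (simp add: n_def)
  have "1 * int n \<le> \<bar>P5_count\<bar> * int n"
    using P5_nonzero by (intro mult_right_mono) auto
  then have "\<bar>2 * P33_count\<bar> < \<bar>P5_count * int n\<bar>"
    unfolding abs_mult using n by simp
  then have small: "\<bar>real_of_int (2 * P33_count)\<bar> < \<bar>real_of_int (P5_count * int n)\<bar>" by linarith
  have "realises (sgn (real_of_int (P5_count * int n + 2 * P33_count)))"
    by (rule realises_edge) (use n small in linarith)+
  also have "sgn (real_of_int (P5_count * int n + 2 * P33_count)) = sgn (real_of_int (P5_count * int n))"
    unfolding of_int_add by (rule sgn_add_small[OF small])
  also have "\<dots> = sgn (real_of_int P5_count)"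
  proof -
    have "0 < int n" using n by linarith
    then show ?thesis unfolding of_int_mult sgn_mult by simp
  qed
  finally show ?thesis .
qed

lemma LTS_case:
  assumes "0 < P5_count" "0 < P5_count + P33_count" "even l \<Longrightarrow> even (card R + l div 2)"
  shows "LTS C"
  using locally_signed[of 1] assms unfolding LTS_def by simp

lemma LTAS_case:
  assumes "P5_count < 0" "P5_count + P33_count < 0" "even l \<Longrightarrow> odd (card R + l div 2)"
  shows "LTAS C"
  using locally_signed[of "- 1"] assms unfolding LTAS_def by simp

text \<open>If \<open>p\<close> and \<open>p + q\<close> differ in sign, edge kernels realise both
  signs. If they agree, the failing condition is the parity one; then \<open>l\<close> is even and
  the triangle realises the opposite sign.\<close>

lemma neither_case:
  assumes "\<not> (0 < P5_count \<and> 0 < P5_count + P33_count \<and> (even l \<longrightarrow> even (card R + l div 2)))"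
    and "\<not> (P5_count < 0 \<and> P5_count + P33_count < 0 \<and> (even l \<longrightarrow> odd (card R + l div 2)))"
  shows "\<not> LTS C \<and> \<not> LTAS C"
proof -
  have "realises 1 \<and> realises (- 1)"
  proof (cases "sgn P5_count = sgn (P5_count + P33_count)")
    case False
    then show ?thesis using realises_P5 realises_sum P5_nonzero sum_nonzero
      by (auto simp: sgn_if split: if_splits)
  next
    case True
    then show ?thesis using realises_P5 realises_triangle assms P5_nonzero sum_nonzero
      by (auto simp: sgn_if split: if_splits)
  qed
  then show ?thesis using not_LTS not_LTAS by blast
qed

end

theorem theorem3p18:
  fixes l t :: nat and R :: "nat rel" and C :: "nat pair_pre_digraph"
  assumes "l \<ge> 3" and "t \<le> l"
    and "R \<subseteq> parcs (directed_cycle l)" and "card R = t"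
    and "C = reverse_arcs R (directed_cycle l)"
    and "signed_count (directed_path 3) C = 0"
    and "signed_count (directed_path 5) C \<notin> {0, - signed_count two_directed_P3 C}"
  shows "let p = signed_count (directed_path 5) C;
             q = signed_count two_directed_P3 C;
             case_i = (p > 0 \<and> p > - q \<and>
                (odd l \<or> (l mod 4 = 0 \<and> even t) \<or> (l mod 4 = 2 \<and> odd t)));
             case_ii = (p < 0 \<and> p < - q \<and>
                (odd l \<or> (l mod 4 = 0 \<and> odd t) \<or> (l mod 4 = 2 \<and> even t)))
         in (case_i \<longrightarrow> LTS C) \<and>
            (case_ii \<longrightarrow> LTAS C) \<and>
            (\<not> case_i \<and> \<not> case_ii \<longrightarrow> \<not> LTS C \<and> \<not> LTAS C)"
proof -
  interpret oriented_cycle l R using assms(1,3) by unfold_locales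
  interpret cycle_statement l R
    using assms(6,7) unfolding assms(5) by unfold_locales (auto simp: P5_count_def P33_count_def)
  have counts: "signed_count (directed_path 5) C = P5_count" "signed_count two_directed_P3 C = P33_count"
    unfolding assms(5) P5_count_def P33_count_def by simp_all
  \<comment> \<open>Both residue conditions combine into one: the parity of
    \<open>card R + l div 2\<close>, the exponent of the sign in \<open>full_cycle\<close>.\<close>
  have half: "l mod 4 = 0 \<longleftrightarrow> even l \<and> even (l div 2)" "l mod 4 = 2 \<longleftrightarrow> even l \<and> odd (l div 2)"
    by presburger+
  have parity_i: "odd l \<or> (l mod 4 = 0 \<and> even t) \<or> (l mod 4 = 2 \<and> odd t)
      \<longleftrightarrow> (even l \<longrightarrow> even (card R + l div 2))"
    unfolding half assms(4) by auto
  have parity_ii: "odd l \<or> (l mod 4 = 0 \<and> odd t) \<or> (l mod 4 = 2 \<and> even t)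
      \<longleftrightarrow> (even l \<longrightarrow> odd (card R + l div 2))"
    unfolding half assms(4) by auto
  have sums: "P5_count > - P33_count \<longleftrightarrow> 0 < P5_count + P33_count"
    "P5_count < - P33_count \<longleftrightarrow> P5_count + P33_count < 0" by auto
  show ?thesis
    unfolding Let_def counts parity_i parity_ii sums
    using LTS_case LTAS_case neither_case unfolding assms(5) by blast
qed

end
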